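(* Let $\theta>0$, $\rho\in\mathbb R$, $v\ge0$, $t>0$ and $q\ge0$. For $\tau\ne0$ with $\tau t<\theta$, let $X_\tau$ be a $(\theta,\tau)$ GMSI process on some $[0,\Delta_\tau)$ with $t<\Delta_\tau\le\infty$ and $\tau\le\theta/\Delta_\tau$, let $Q_\tau(s)=v+Z_\tau(s)+L_\tau(s)$, $0\le s<\Delta_\tau$, be the queue-length process with net input $Z_\tau(s)=\rho s+X_\tau(s)$ and initial value $v$, and let $F_{0;\vec0,v}(t;q)=P(Q_\tau(t)\le q)$ (which depends on $\tau$). Then $$\lim_{\tau\to0}F_{0;\vec0,v}(t;q)=\frac12\left(1-e^{\frac{2\rho q}{\theta}}-\mathrm{erf}\!\left(\frac{-q+\rho t+v}{\sqrt{2\theta t}}\right)+e^{\frac{2\rho q}{\theta}}\,\mathrm{erf}\!\left(\frac{q+\rho t+v}{\sqrt{2\theta t}}\right)\right).$$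
   Context: A $(\theta,\tau)$ GMSI process on $[0,\Delta)$ (where $0<\Delta\le\infty$, $\theta>0$, $\tau\le\theta/\Delta$, with $\theta/\infty=0$) is a real, continuous, zero-mean Gaussian Markov process $X$ with $X(0)=0$, stationary increments, and covariance $E[X(s)X(t)]=s(\theta-\tau t)$ for $0\le s\le t<\Delta$. Queue-length process: given a continuous net input $Z$ with $Z(0)=0$ and $Q(0)\ge0$, $Q(t)=Q(0)+Z(t)+L(t)$, where $L$ is the (unique) continuous non-decreasing function with $L(0)=0$ that increases only when $Q=0$ and is such that $Q(t)\ge0$ for all $t$ in the time domain. $\mathrm{erf}(z)=2\pi^{-1/2}\int_0^z e^{-t^2}\,dt$. *)

theory Defs
  imports "HOL-Probability.Probability"
begin

definition erf :: "real \<Rightarrow> real" where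
  "erf z = 2 / sqrt pi * (LBINT u=0..z. exp (- u\<^sup>2))"

definition time_domain :: "ereal \<Rightarrow> real set" where
  "time_domain \<Delta> = {s. 0 \<le> s \<and> ereal s < \<Delta>}"

text \<open>Point masses count as (degenerate) normal laws; for instance \<open>X 0\<close> below is constant.\<close>

definition gaussian_rv :: "'a measure \<Rightarrow> ('a \<Rightarrow> real) \<Rightarrow> bool" where
  "gaussian_rv M Y \<longleftrightarrow> Y \<in> borel_measurable M \<and>
     (\<exists>\<mu> \<sigma>. (0 < \<sigma> \<and> distributed M lborel Y (normal_density \<mu> \<sigma>)) \<or>
            (\<sigma> = 0 \<and> (AE \<omega> in M. Y \<omega> = \<mu>)))"

text \<open>All finite-dimensional distributions are multivariate normal, i.e. every finite linear
  combination of the values is univariate normal.\<close>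

definition gaussian_process :: "'a measure \<Rightarrow> real set \<Rightarrow> (real \<Rightarrow> 'a \<Rightarrow> real) \<Rightarrow> bool" where
  "gaussian_process M D X \<longleftrightarrow>
     (\<forall>J c. finite J \<and> J \<subseteq> D \<longrightarrow> gaussian_rv M (\<lambda>\<omega>. \<Sum>s\<in>J. c s * X s \<omega>))"

definition generated_algebra :: "'a measure \<Rightarrow> (real \<Rightarrow> 'a \<Rightarrow> real) \<Rightarrow> real set \<Rightarrow> 'a measure" where
  "generated_algebra M X S =
     sigma (space M) {X u -` B \<inter> space M | u B. u \<in> S \<and> B \<in> sets borel}"

definition markov_process :: "'a measure \<Rightarrow> real set \<Rightarrow> (real \<Rightarrow> 'a \<Rightarrow> real) \<Rightarrow> bool" where
  "markov_process M D X \<longleftrightarrow>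
     (\<forall>s\<in>D. X s \<in> borel_measurable M) \<and>
     (\<forall>s\<in>D. \<forall>t\<in>D. \<forall>B\<in>sets borel. s \<le> t \<longrightarrow>
        (AE \<omega> in M.
           real_cond_exp M (generated_algebra M X {u\<in>D. u \<le> s})
             (indicator (X t -` B \<inter> space M)) \<omega> =
           real_cond_exp M (generated_algebra M X {s})
             (indicator (X t -` B \<inter> space M)) \<omega>))"

definition stationary_increments :: "'a measure \<Rightarrow> real set \<Rightarrow> (real \<Rightarrow> 'a \<Rightarrow> real) \<Rightarrow> bool" where
  "stationary_increments M D X \<longleftrightarrow>
     (\<forall>s h r. 0 \<le> h \<and> s \<in> D \<and> s + h \<in> D \<and> r \<in> D \<and> r + h \<in> D \<longrightarrow>
        distr M borel (\<lambda>\<omega>. X (s + h) \<omega> - X s \<omega>) = distr M borel (\<lambda>\<omega>. X (r + h) \<omega> - X r \<omega>))"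

text \<open>Only the values \<open>X s\<close> with \<open>s\<close> in the time domain matter.  In \<^typ>\<open>ereal\<close>,
  \<open>\<theta> / \<infinity> = 0\<close>.\<close>

definition gmsi_process ::
  "'a measure \<Rightarrow> real \<Rightarrow> real \<Rightarrow> ereal \<Rightarrow> (real \<Rightarrow> 'a \<Rightarrow> real) \<Rightarrow> bool" where
  "gmsi_process M \<theta> \<tau> \<Delta> X \<longleftrightarrow>
     prob_space M \<and> 0 < \<Delta> \<and> 0 < \<theta> \<and> ereal \<tau> \<le> ereal \<theta> / \<Delta> \<and>
     (\<forall>\<omega>\<in>space M. continuous_on (time_domain \<Delta>) (\<lambda>s. X s \<omega>) \<and> X 0 \<omega> = 0) \<and>
     gaussian_process M (time_domain \<Delta>) X \<and>
     markov_process M (time_domain \<Delta>) X \<and>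
     stationary_increments M (time_domain \<Delta>) X \<and>
     (\<forall>s\<in>time_domain \<Delta>. (LINT \<omega>|M. X s \<omega>) = 0) \<and>
     (\<forall>s\<in>time_domain \<Delta>. \<forall>t\<in>time_domain \<Delta>. s \<le> t \<longrightarrow>
        (LINT \<omega>|M. X s \<omega> * X t \<omega>) = s * (\<theta> - \<tau> * t))"

text \<open>The last conjunct says that \<open>l\<close> increases only when the queue is empty: over any interval
  on which it grows, the queue length vanishes somewhere.\<close>

definition regulator_path ::
  "real set \<Rightarrow> real \<Rightarrow> (real \<Rightarrow> real) \<Rightarrow> (real \<Rightarrow> real) \<Rightarrow> bool" where
  "regulator_path D q0 z l \<longleftrightarrow>
     continuous_on D l \<and> mono_on D l \<and> l 0 = 0 \<and>
     (\<forall>s\<in>D. 0 \<le> q0 + z s + l s) \<and>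
     (\<forall>a\<in>D. \<forall>b\<in>D. a \<le> b \<and> l a < l b \<longrightarrow> (\<exists>s\<in>{a..b}. q0 + z s + l s = 0))"

definition queue_length_path ::
  "real set \<Rightarrow> real \<Rightarrow> (real \<Rightarrow> real) \<Rightarrow> (real \<Rightarrow> real) \<Rightarrow> bool" where
  "queue_length_path D q0 z Q \<longleftrightarrow>
     (\<exists>l. regulator_path D q0 z l \<and> (\<forall>s\<in>D. Q s = q0 + z s + l s))"

end

theory Submission
  imports Defs "HOL-Real_Asymp.Real_Asymp"
begin

text \<open>
  Write \<open>Z s = \<rho> * s + X s\<close>. Unfolding the regulator, \<open>Q t \<le> q\<close> holds iff \<open>v + Z t \<le> q\<close> and
  \<open>Z t - Z s \<le> q\<close> for all \<open>s \<le> t\<close>. The bridge \<open>X s - (s / t) * X t\<close> is independent of \<open>X t\<close> and has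
  the law of a Brownian bridge with variance parameter \<open>\<theta>\<close>, whatever \<open>\<tau>\<close> is. Hence reweighting the
  probability measure by a function of \<open>Z t\<close> alone, the quotient of the \<open>N(0, \<theta> * t)\<close> density by
  the density of \<open>Z t\<close>, turns \<open>Z\<close> into a driftless Brownian motion on \<open>{0..t}\<close>. There the reflection
  principle, applied to the time-reversed path \<open>Z t - Z (t - s)\<close>, gives the joint law of crossing the
  level \<open>q\<close> and of \<open>Z t\<close>; undoing the reweighting yields the distribution of \<open>Q t\<close> in closed form
  for every \<open>\<tau>\<close>, and this expression is continuous at \<open>\<tau> = 0\<close>.
\<close>

subsection \<open>Independence from characteristic functions\<close>


text \<open>Reweighting the endpoint suffices because the drift \<open>\<rho>\<close> and the
  parameter \<open>\<tau>\<close> enter the path through \<open>Z t\<close> alone: the bridge of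
  \<open>Z\<close> is the bridge of \<open>X\<close>. Thus neither a Girsanov argument on path space
  nor a reference Brownian motion is involved; Brownian behaviour under the new measure is read off
  from the characteristic function of finitely many increments, and independence has to be derived
  from it. Time reversal turns the family of bounds \<open>Z t - Z s \<le> q\<close> into one
  constant level \<open>q\<close> for one path, and that path still ends in \<open>Z t\<close>, the
  variable that carries the weight. The constant \<open>b = 2 * q / (\<theta> * t)\<close> comes
  from reflecting the endpoint at \<open>q\<close>: with \<open>f\<close> the
  \<open>N(0, \<theta> * t)\<close> density, \<open>f (2 * q - z) / f z = exp (b * (z - q))\<close>.
  Neither \<open>f\<close> nor \<open>b\<close> depends on \<open>\<tau>\<close>. Multiplied by the
  true density of \<open>Z t\<close>, this factor gives a multiple of a shifted normal density,
  hence the second \<open>erf\<close> term. \<open>\<tau>\<close> survives only in the variance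
  \<open>t * (\<theta> - \<tau> * t)\<close> of \<open>Z t\<close>.\<close>

text \<open>Normalised, the weight \<open>w\<close> is a probability density under which \<open>X\<close> has the same characteristic
  function, hence the same law. This one-dimensional uniqueness, used for one variable after the
  other, replaces a multivariate uniqueness theorem.\<close>

lemma (in prob_space) weighted_prob_from_char_nonneg:
  fixes w X :: "'a \<Rightarrow> real"
  assumes X[measurable]: "X \<in> borel_measurable M" and w[measurable]: "w \<in> borel_measurable M"
    and w0: "\<And>\<omega>. \<omega> \<in> space M \<Longrightarrow> 0 \<le> w \<omega>" and wK: "\<And>\<omega>. \<omega> \<in> space M \<Longrightarrow> w \<omega> \<le> K"
    and eq: "\<And>s. (LINT \<omega>|M. w \<omega> * iexp (s * X \<omega>)) = complex_of_real c * char (distr M borel X) s"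
    and A[measurable]: "A \<in> sets borel"
  shows "(LINT \<omega>|M. w \<omega> * indicator A (X \<omega>)) = c * prob (X -` A \<inter> space M)"
proof -
  interpret D: real_distribution "distr M borel X" by (rule real_distribution_distr) simp
  have intw: "integrable M w"
    by (rule integrable_const_bound[where B=K]) (use w0 wK in auto)
  \<comment> \<open>At frequency \<open>0\<close> the hypothesis identifies \<open>c\<close> with
    the total mass of the weight, the constant to normalise by.\<close>
  have "complex_of_real (LINT \<omega>|M. w \<omega>) = c"
    using eq[of 0] by (simp add: D.char_zero)
  then have c: "(LINT \<omega>|M. w \<omega>) = c" by simp
  show ?thesis
  proof (cases "c = 0")
    case True
    then have "AE \<omega> in M. w \<omega> = 0"
      using integral_nonneg_eq_0_iff_AE[OF intw] w0 c by auto
    then have "(LINT \<omega>|M. w \<omega> * indicator A (X \<omega>)) = (LINT \<omega>|M. 0)"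
      by (intro integral_cong_AE) auto
    with True show ?thesis by simp
  next
    case False
    have "0 \<le> c" using c w0 by (metis Bochner_Integration.integral_nonneg)
    with False have cpos: "0 < c" by simp
    define N where "N = density M (\<lambda>\<omega>. w \<omega> / c)"
    have AEw: "AE \<omega> in M. 0 \<le> w \<omega> / c" using w0 cpos by auto
    have "emeasure N (space N) = (\<integral>\<^sup>+\<omega>. w \<omega> / c \<partial>M)"
      unfolding N_def by (auto simp: emeasure_density intro!: nn_integral_cong)
    also have "\<dots> = ennreal (LINT \<omega>|M. w \<omega> / c)"
      by (rule nn_integral_eq_integral) (use intw AEw in auto)
    also have "\<dots> = 1" using c cpos by simp
    finally interpret N: prob_space N by (rule prob_spaceI)
    have XN[measurable]: "X \<in> borel_measurable N" by (simp add: N_def)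
    have "char (distr N borel X) s = char (distr M borel X) s" for s
    proof -
      have "char (distr N borel X) s = (LINT \<omega>|N. iexp (s * X \<omega>))"
        unfolding char_def by (subst integral_distr) auto
      also have "\<dots> = (LINT \<omega>|M. (w \<omega> / c) *\<^sub>R iexp (s * X \<omega>))"
        unfolding N_def by (subst integral_density) (use AEw in auto)
      also have "\<dots> = (LINT \<omega>|M. (1 / c) *\<^sub>R (w \<omega> * iexp (s * X \<omega>)))"
        by (intro Bochner_Integration.integral_cong) (auto simp: scaleR_conv_of_real)
      also have "\<dots> = char (distr M borel X) s"
        using eq[of s] cpos by (simp add: scaleR_conv_of_real)
      finally show ?thesis .
    qed
    then have dist: "distr N borel X = distr M borel X"
      by (intro Levy_uniqueness N.real_distribution_distr real_distribution_distr) auto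
    have "(LINT \<omega>|M. w \<omega> * indicator A (X \<omega>)) = (LINT \<omega>|M. c * ((w \<omega> / c) *\<^sub>R indicator A (X \<omega>)))"
      using cpos by (intro Bochner_Integration.integral_cong) auto
    also have "\<dots> = c * (LINT \<omega>|N. indicator A (X \<omega>))"
      unfolding N_def by (subst integral_density) (use AEw in auto)
    also have "(LINT \<omega>|N. indicator A (X \<omega>) :: real) = (LINT x|distr N borel X. indicator A x)"
      by (subst integral_distr) auto
    also have "\<dots> = prob (X -` A \<inter> space M)"
      unfolding dist by (simp add: measure_distr)
    finally show ?thesis .
  qed
qed

text \<open>Adding \<open>K\<close> makes the weight nonnegative. The constant weight
  \<open>K\<close> satisfies the hypothesis with factor \<open>K\<close>, and hypothesis and
  conclusion are linear in weight and factor, so the shift can be subtracted again.\<close>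

lemma (in prob_space) weighted_prob_from_char_real:
  fixes w X :: "'a \<Rightarrow> real"
  assumes X[measurable]: "X \<in> borel_measurable M" and w[measurable]: "w \<in> borel_measurable M"
    and wK: "\<And>\<omega>. \<omega> \<in> space M \<Longrightarrow> \<bar>w \<omega>\<bar> \<le> K"
    and eq: "\<And>s. (LINT \<omega>|M. w \<omega> * iexp (s * X \<omega>)) = complex_of_real c * char (distr M borel X) s"
    and A[measurable]: "A \<in> sets borel"
  shows "(LINT \<omega>|M. w \<omega> * indicator A (X \<omega>)) = c * prob (X -` A \<inter> space M)"
proof -
  have intw: "integrable M w"
    by (rule integrable_const_bound[where B=K]) (use wK in auto)
  have int1: "integrable M (\<lambda>\<omega>. w \<omega> * iexp (s * X \<omega>))" for s
    by (rule integrable_const_bound[where B=K]) (use wK in \<open>auto simp: norm_mult\<close>)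
  have int2: "integrable M (\<lambda>\<omega>. complex_of_real K * iexp (s * X \<omega>))" for s
    by (rule integrable_const_bound[where B="\<bar>K\<bar>"]) (auto simp: norm_mult)
  have K0: "0 \<le> K" using not_empty wK by (meson abs_ge_zero ex_in_conv order_trans)
  have int3: "integrable M (\<lambda>\<omega>. w \<omega> * indicator A (X \<omega>))"
    by (rule integrable_const_bound[where B=K]) (use wK K0 in \<open>auto simp: indicator_def\<close>)
  have int4: "integrable M (\<lambda>\<omega>. K * indicator A (X \<omega>))"
    by (rule integrable_const_bound[where B="\<bar>K\<bar>"]) (auto simp: indicator_def)
  have "(LINT \<omega>|M. (w \<omega> + K) * indicator A (X \<omega>)) = (c + K) * prob (X -` A \<inter> space M)"
  proof (rule weighted_prob_from_char_nonneg[where K="2 * K"])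
    fix s
    have "(LINT \<omega>|M. complex_of_real (w \<omega> + K) * iexp (s * X \<omega>))
        = (LINT \<omega>|M. w \<omega> * iexp (s * X \<omega>) + complex_of_real K * iexp (s * X \<omega>))"
      by (simp add: algebra_simps)
    also have "\<dots> = (LINT \<omega>|M. w \<omega> * iexp (s * X \<omega>)) + K * (LINT \<omega>|M. iexp (s * X \<omega>))"
      by (subst Bochner_Integration.integral_add[OF int1 int2]) simp
    also have "(LINT \<omega>|M. iexp (s * X \<omega>)) = char (distr M borel X) s"
      unfolding char_def by (subst integral_distr) auto
    finally show "(LINT \<omega>|M. complex_of_real (w \<omega> + K) * iexp (s * X \<omega>))
        = complex_of_real (c + K) * char (distr M borel X) s"
      by (simp only: eq of_real_add distrib_right)
  qed (use wK in \<open>auto simp: abs_le_iff\<close>, force+)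
  moreover have "(LINT \<omega>|M. (w \<omega> + K) * indicator A (X \<omega>))
      = (LINT \<omega>|M. w \<omega> * indicator A (X \<omega>)) + (LINT \<omega>|M. K * indicator A (X \<omega>))"
    by (subst Bochner_Integration.integral_add[OF int3 int4, symmetric]) (simp add: algebra_simps)
  moreover have "(LINT \<omega>|M. K * indicator A (X \<omega>)) = K * prob (X -` A \<inter> space M)"
  proof -
    have "(LINT \<omega>|M. indicator A (X \<omega>) :: real) = (LINT \<omega>|M. indicator (X -` A \<inter> space M) \<omega>)"
      by (intro Bochner_Integration.integral_cong) (auto simp: indicator_def)
    then show ?thesis by simp
  qed
  ultimately show ?thesis unfolding distrib_right by linarith
qed

text \<open>Conjugating the hypothesis at \<open>- s\<close> gives the same identity for the weight
  \<open>cnj (w \<omega>)\<close> with factor \<open>cnj c\<close>; the real and imaginary parts are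
  combinations of the two. Complex weights are wanted because exponentials of further variables will
  serve as weights.\<close>

lemma (in prob_space) weighted_prob_from_char:
  fixes w :: "'a \<Rightarrow> complex" and X :: "'a \<Rightarrow> real"
  assumes X[measurable]: "X \<in> borel_measurable M" and w[measurable]: "w \<in> borel_measurable M"
    and wK: "\<And>\<omega>. \<omega> \<in> space M \<Longrightarrow> norm (w \<omega>) \<le> K"
    and eq: "\<And>s. (LINT \<omega>|M. w \<omega> * iexp (s * X \<omega>)) = c * char (distr M borel X) s"
    and A[measurable]: "A \<in> sets borel"
  shows "(LINT \<omega>|M. w \<omega> * indicator A (X \<omega>)) = c * prob (X -` A \<inter> space M)"
proof -
  have int1: "integrable M (\<lambda>\<omega>. w \<omega> * iexp (s * X \<omega>))" for s
    by (rule integrable_const_bound[where B=K]) (use wK in \<open>auto simp: norm_mult\<close>)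
  have [measurable]: "cnj \<in> borel_measurable borel"
    by (intro borel_measurable_continuous_onI continuous_intros)
  have int2: "integrable M (\<lambda>\<omega>. cnj (w \<omega>) * iexp (s * X \<omega>))" for s
    by (rule integrable_const_bound[where B=K]) (use wK in \<open>auto simp: norm_mult\<close>)
  have charM: "char (distr M borel X) s = (LINT \<omega>|M. iexp (s * X \<omega>))" for s
    unfolding char_def by (subst integral_distr) auto
  have cnj_char: "cnj (char (distr M borel X) (- s)) = char (distr M borel X) s" for s
    unfolding charM by (simp flip: Bochner_Integration.integral_cnj add: exp_cnj)
  have eqc: "(LINT \<omega>|M. cnj (w \<omega>) * iexp (s * X \<omega>)) = cnj c * char (distr M borel X) s" for s
  proof -
    have "(LINT \<omega>|M. cnj (w \<omega>) * iexp (s * X \<omega>)) = cnj (LINT \<omega>|M. w \<omega> * iexp (- s * X \<omega>))"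
      by (simp flip: Bochner_Integration.integral_cnj add: exp_cnj)
    then show ?thesis by (subst (asm) eq) (simp add: cnj_char)
  qed
  have R: "(LINT \<omega>|M. Re (w \<omega>) * indicator A (X \<omega>)) = Re c * prob (X -` A \<inter> space M)"
  proof (rule weighted_prob_from_char_real[where K=K])
    fix s
    have "(LINT \<omega>|M. complex_of_real (Re (w \<omega>)) * iexp (s * X \<omega>))
        = (LINT \<omega>|M. (w \<omega> * iexp (s * X \<omega>) + cnj (w \<omega>) * iexp (s * X \<omega>)) / 2)"
      by (intro Bochner_Integration.integral_cong) (auto simp: complex_add_cnj simp flip: distrib_right)
    also have "\<dots> = (c * char (distr M borel X) s + cnj c * char (distr M borel X) s) / 2"
      by (simp add: Bochner_Integration.integral_add[OF int1 int2] eq[unfolded mult.assoc] eqc eq del: of_real_mult)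
    also have "\<dots> = complex_of_real (Re c) * char (distr M borel X) s"
      by (simp add: complex_add_cnj flip: distrib_right)
    finally show "(LINT \<omega>|M. complex_of_real (Re (w \<omega>)) * iexp (s * X \<omega>))
        = complex_of_real (Re c) * char (distr M borel X) s" .
  qed (use wK in \<open>auto intro: order_trans[OF abs_Re_le_cmod]\<close>)
  have Im_eq: "complex_of_real (Im z) = (z - cnj z) / (2 * \<i>)" for z
    by (simp add: complex_eq_iff)
  have I: "(LINT \<omega>|M. Im (w \<omega>) * indicator A (X \<omega>)) = Im c * prob (X -` A \<inter> space M)"
  proof (rule weighted_prob_from_char_real[where K=K])
    fix s
    have "(LINT \<omega>|M. complex_of_real (Im (w \<omega>)) * iexp (s * X \<omega>))
        = (LINT \<omega>|M. (w \<omega> * iexp (s * X \<omega>) - cnj (w \<omega>) * iexp (s * X \<omega>)) / (2 * \<i>))"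
      by (intro Bochner_Integration.integral_cong) (simp_all only: Im_eq left_diff_distrib times_divide_eq_left)
    also have "\<dots> = (c * char (distr M borel X) s - cnj c * char (distr M borel X) s) / (2 * \<i>)"
      by (simp add: Bochner_Integration.integral_diff[OF int1 int2] eqc eq del: of_real_mult)
    also have "\<dots> = complex_of_real (Im c) * char (distr M borel X) s"
      by (simp only: Im_eq left_diff_distrib times_divide_eq_left)
    finally show "(LINT \<omega>|M. complex_of_real (Im (w \<omega>)) * iexp (s * X \<omega>))
        = complex_of_real (Im c) * char (distr M borel X) s" .
  qed (use wK in \<open>auto intro: order_trans[OF abs_Im_le_cmod]\<close>)
  have K0: "0 \<le> K" using not_empty wK by (meson norm_ge_zero ex_in_conv order_trans)
  have int: "integrable M (\<lambda>\<omega>. w \<omega> * indicator A (X \<omega>))"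
    by (rule integrable_const_bound[where B=K]) (use wK K0 in \<open>auto simp: indicator_def\<close>)
  have "Re (indicator A x) = indicator A x" "Im (indicator A x) = 0" for x
    by (auto simp: indicator_def)
  then show ?thesis
    by (intro complex_eqI)
       (simp_all add: integral_Re[OF int, symmetric] integral_Im[OF int, symmetric] R I)
qed

text \<open>Exponentials are traded for indicators one variable at a time. While \<open>X k\<close>
  is treated, the indicators already obtained and the exponentials still left form a complex weight
  of norm at most \<open>1\<close>. With indicators only, the identity is the product rule for
  events.\<close>

lemma (in prob_space) indep_vars_from_char:
  fixes X :: "'i \<Rightarrow> 'a \<Rightarrow> real"
  assumes fin: "finite I" and ne: "I \<noteq> {}"
    and X[measurable]: "\<And>i. i \<in> I \<Longrightarrow> X i \<in> borel_measurable M"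
    and eq: "\<And>u. (LINT \<omega>|M. (\<Prod>i\<in>I. iexp (u i * X i \<omega>))) = (\<Prod>i\<in>I. char (distr M borel (X i)) (u i))"
  shows "indep_vars (\<lambda>_. borel) X I"
proof -
  \<comment> \<open>Mixed stage: \<open>K\<close> holds the indices already turned into indicators.
    The frequencies \<open>u\<close> stay arbitrary, since the induction step needs every frequency
    of the variable it converts.\<close>
  have main: "(LINT \<omega>|M. (\<Prod>i\<in>K. indicator (A i) (X i \<omega>)) * (\<Prod>i\<in>I - K. iexp (u i * X i \<omega>)))
      = (\<Prod>i\<in>K. complex_of_real (prob (X i -` A i \<inter> space M))) * (\<Prod>i\<in>I - K. char (distr M borel (X i)) (u i))"
    if "K \<subseteq> I" and A: "\<And>i. i \<in> I \<Longrightarrow> A i \<in> sets borel" for K u A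
  proof -
    have "finite K" using that fin finite_subset by auto
    then show ?thesis using that(1)
    proof (induction K arbitrary: u rule: finite_induct)
      case empty
      then show ?case using eq[of u] by simp
    next
      case (insert k K)
      have k: "k \<in> I" "k \<notin> K" "K \<subseteq> I" using insert by auto
      define J where "J = I - insert k K"
      have J: "I - K = insert k J" "k \<notin> J" "finite J" "J \<subseteq> I"
        using k fin by (auto simp: J_def)
      define w where "w = (\<lambda>\<omega>. (\<Prod>i\<in>K. indicator (A i) (X i \<omega>)) * (\<Prod>i\<in>J. iexp (u i * X i \<omega>)))"
      define c where "c = (\<Prod>i\<in>K. complex_of_real (prob (X i -` A i \<inter> space M))) * (\<Prod>i\<in>J. char (distr M borel (X i)) (u i))"
      have XK: "X i \<in> borel_measurable M" if "i \<in> K" for i using that k by auto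
      have XJ: "X i \<in> borel_measurable M" if "i \<in> J" for i using that J by auto
      have AK: "A i \<in> sets borel" if "i \<in> K" for i using that k A by auto
      have "(LINT \<omega>|M. w \<omega> * indicator (A k) (X k \<omega>)) = c * prob (X k -` A k \<inter> space M)"
      proof (rule weighted_prob_from_char[where K=1])
        show "X k \<in> borel_measurable M" using k by simp
        show "A k \<in> sets borel" using k A by simp
        show "w \<in> borel_measurable M" unfolding w_def
        proof (intro borel_measurable_times borel_measurable_prod)
          fix i assume "i \<in> K"
          with XK AK have [measurable]: "X i \<in> borel_measurable M" "A i \<in> sets borel" by auto
          show "(\<lambda>\<omega>. indicator (A i) (X i \<omega>) :: complex) \<in> borel_measurable M" by measurable
        next
          fix i assume "i \<in> J"
          with XJ have [measurable]: "X i \<in> borel_measurable M" by auto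
          show "(\<lambda>\<omega>. iexp (u i * X i \<omega>)) \<in> borel_measurable M" by measurable
        qed
        show "norm (w \<omega>) \<le> 1" for \<omega>
        proof -
          have "norm (\<Prod>i\<in>K. indicator (A i) (X i \<omega>) :: complex) \<le> 1"
            by (subst norm_prod_le[THEN order_trans]) (auto intro!: prod_le_1 simp: indicator_def)
          moreover have "norm (\<Prod>i\<in>J. iexp (u i * X i \<omega>)) = 1"
            by (simp add: prod_norm[symmetric])
          ultimately show ?thesis by (simp add: w_def norm_mult)
        qed
        fix s
        define u' where "u' = u(k := s)"
        have u': "(\<Prod>i\<in>J. f i (u' i)) = (\<Prod>i\<in>J. f i (u i))" for f :: "'i \<Rightarrow> real \<Rightarrow> complex"
          using J by (intro prod.cong) (auto simp: u'_def)
        have u'k: "u' k = s" by (simp add: u'_def)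
        have "(LINT \<omega>|M. w \<omega> * iexp (s * X k \<omega>)) =
          (LINT \<omega>|M. (\<Prod>i\<in>K. indicator (A i) (X i \<omega>)) * (\<Prod>i\<in>I - K. iexp (u' i * X i \<omega>)))"
          unfolding w_def J(1) using J(2,3) u'[of "\<lambda>i a. iexp (a * X i _)"]
          by (simp add: u'k mult_ac u'[of "\<lambda>i a. iexp (a * X i _)"])
        also have "\<dots> = c * char (distr M borel (X k)) s"
          using J(2,3)
          by (subst insert.IH[OF k(3)]) (simp add: J(1) c_def u'k mult_ac u'[of "\<lambda>i a. char (distr M borel (X i)) a"])
        finally show "(LINT \<omega>|M. w \<omega> * iexp (s * X k \<omega>)) = c * char (distr M borel (X k)) s" .
      qed
      then show ?case
        using insert(1,2) by (simp add: w_def c_def J_def mult_ac)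
    qed
  qed
  have prodA: "prob (\<Inter>i\<in>I. X i -` A i \<inter> space M) = (\<Prod>i\<in>I. prob (X i -` A i \<inter> space M))"
    if A: "\<And>i. i \<in> I \<Longrightarrow> A i \<in> sets borel" for A
  proof -
    have "(\<Prod>i\<in>I. indicator (A i) (X i \<omega>)) = (complex_of_real (indicator (\<Inter>i\<in>I. X i -` A i \<inter> space M) \<omega>))"
      if "\<omega> \<in> space M" for \<omega>
      using fin ne that
      by (cases "\<omega> \<in> (\<Inter>i\<in>I. X i -` A i \<inter> space M)") (auto simp: indicator_def intro!: prod.neutral)
    then have "(LINT \<omega>|M. (\<Prod>i\<in>I. indicator (A i) (X i \<omega>))) = 
      (LINT \<omega>|M. complex_of_real (indicator (\<Inter>i\<in>I. X i -` A i \<inter> space M) \<omega>))"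
      by (intro Bochner_Integration.integral_cong) auto
    also have "\<dots> = complex_of_real (prob (\<Inter>i\<in>I. X i -` A i \<inter> space M))"
      using ne by (subst integral_complex_of_real) (auto simp: Int_absorb2 INT_subset_iff)
    finally have "complex_of_real (prob (\<Inter>i\<in>I. X i -` A i \<inter> space M))
       = complex_of_real (\<Prod>i\<in>I. prob (X i -` A i \<inter> space M))"
      using main[of I A] A by simp
    then show ?thesis using of_real_eq_iff by blast
  qed
  have "indep_sets (\<lambda>i. {X i -` A \<inter> space M | A. A \<in> sets borel}) I"
  proof (subst indep_sets_finite[OF ne fin])
    show "\<forall>A\<in>Pi I (\<lambda>i. {X i -` A \<inter> space M |A. A \<in> sets borel}). prob (\<Inter> (A ` I)) = (\<Prod>j\<in>I. prob (A j))"
    proof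
      fix B assume "B \<in> Pi I (\<lambda>i. {X i -` A \<inter> space M |A. A \<in> sets borel})"
      then have "\<forall>i\<in>I. \<exists>A. B i = X i -` A \<inter> space M \<and> A \<in> sets borel" by auto
      then obtain A where "\<And>i. i \<in> I \<Longrightarrow> B i = X i -` A i \<inter> space M \<and> A i \<in> sets borel" by metis
      then show "prob (\<Inter> (B ` I)) = (\<Prod>j\<in>I. prob (B j))" using prodA[of A] by auto
    qed
  qed (auto intro: exI[of _ UNIV])
  then show ?thesis unfolding indep_vars_def2 using X by auto
qed

subsection \<open>Reflection principle\<close>

text \<open>First passage in step \<open>k\<close> is decided by the first \<open>k\<close>
  increments, while the sum \<open>R\<close> of the later ones is independent of them and symmetric.
  Replacing \<open>R\<close> by \<open>- R\<close> keeps the joint law and turns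
  \<open>S k + R \<le> c\<close> into \<open>2 * S k - c \<le> S n\<close>.\<close>

lemma (in prob_space) reflect_increment:
  fixes \<xi> :: "nat \<Rightarrow> 'a \<Rightarrow> real"
  assumes ind: "indep_vars (\<lambda>_. borel) \<xi> {..<n}"
    and sym: "\<And>i u. i < n \<Longrightarrow> char (distr M borel (\<xi> i)) (- u) = char (distr M borel (\<xi> i)) u"
    and "k \<le> n" and S: "\<And>k \<omega>. S k \<omega> = (\<Sum>i<k. \<xi> i \<omega>)"
  shows "prob {\<omega> \<in> space M. (a < S k \<omega> \<and> (\<forall>j<k. S j \<omega> \<le> a)) \<and> S n \<omega> \<le> c}
       = prob {\<omega> \<in> space M. (a < S k \<omega> \<and> (\<forall>j<k. S j \<omega> \<le> a)) \<and> 2 * S k \<omega> - c \<le> S n \<omega>}"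
proof -
  have \<xi>[measurable]: "\<xi> i \<in> borel_measurable M" if "i < n" for i
    using ind that by (auto simp: indep_vars_def)
  define V where "V = (\<lambda>\<omega>. restrict (\<lambda>i. \<xi> i \<omega>) {..<k})"
  define R where "R = (\<lambda>\<omega>. \<Sum>i\<in>{k..<n}. \<xi> i \<omega>)"
  let ?P = "PiM {..<k} (\<lambda>_. borel :: real measure)"
  \<comment> \<open>\<open>indep_var\<close> wants both variables to have values of one type, so the
    real \<open>R\<close> is stored as a function on \<open>{0}\<close>, next to the vector
    \<open>V\<close>.\<close>
  let ?Q = "PiM {0::nat} (\<lambda>_. borel :: real measure)"
  let ?c = "\<lambda>r::real. \<lambda>i\<in>{0::nat}. r"
  have indVR: "indep_var ?P V ?Q (\<lambda>\<omega>. ?c (g (R \<omega>)))" if [measurable]: "g \<in> borel_measurable borel" for g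
  proof -
    have "indep_var ?P V (PiM {k..<n} (\<lambda>_. borel)) (\<lambda>\<omega>. restrict (\<lambda>i. \<xi> i \<omega>) {k..<n})"
      unfolding V_def using \<open>k \<le> n\<close> by (intro indep_var_restrict[OF ind]) auto
    then have "indep_var ?P ((\<lambda>x. x) \<circ> V) ?Q ((\<lambda>x. ?c (g (\<Sum>i\<in>{k..<n}. x i))) \<circ> (\<lambda>\<omega>. restrict (\<lambda>i. \<xi> i \<omega>) {k..<n}))"
      by (rule indep_var_compose) measurable
    then show ?thesis by (simp add: R_def comp_def)
  qed
  from indVR[of "\<lambda>x. x"] have Vm[measurable]: "V \<in> measurable M ?P" by (auto dest: indep_var_rv1)
  have Rm[measurable]: "R \<in> borel_measurable M" unfolding R_def by measurable
  \<comment> \<open>The characteristic function of \<open>R\<close> is a product of even functions,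
    hence even.\<close>
  have "char (distr M borel (\<lambda>\<omega>. - R \<omega>)) u = char (distr M borel R) u" for u
  proof -
    have "char (distr M borel (\<lambda>\<omega>. - R \<omega>)) u = char (distr M borel R) (- u)"
      by (simp add: char_def integral_distr)
    also have "\<dots> = char (distr M borel R) u"
      unfolding R_def using sym
      by (subst (1 2) char_distr_sum[OF indep_vars_subset[OF ind]]) auto
    finally show ?thesis .
  qed
  then have "distr M borel (\<lambda>\<omega>. - R \<omega>) = distr M borel R"
    by (intro Levy_uniqueness real_distribution_distr) auto
  then have "distr (distr M borel (\<lambda>\<omega>. - R \<omega>)) ?Q ?c = distr (distr M borel R) ?Q ?c" by simp
  then have dc: "distr M ?Q (\<lambda>\<omega>. ?c (- R \<omega>)) = distr M ?Q (\<lambda>\<omega>. ?c (R \<omega>))"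
    by (subst (asm) (1 2) distr_distr) (auto simp: comp_def)
  have "distr M ?P V \<Otimes>\<^sub>M distr M ?Q (\<lambda>\<omega>. ?c (g (R \<omega>))) = distr M (?P \<Otimes>\<^sub>M ?Q) (\<lambda>\<omega>. (V \<omega>, ?c (g (R \<omega>))))"
    if "g \<in> borel_measurable borel" for g
    using indVR[OF that] by (simp only: indep_var_distribution_eq)
  from this[of "\<lambda>x. x"] this[of uminus]
  have joint: "distr M (?P \<Otimes>\<^sub>M ?Q) (\<lambda>\<omega>. (V \<omega>, ?c (R \<omega>))) = distr M (?P \<Otimes>\<^sub>M ?Q) (\<lambda>\<omega>. (V \<omega>, ?c (- R \<omega>)))"
    by (simp add: dc)
  define C where "C = {x \<in> space (?P \<Otimes>\<^sub>M ?Q).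
      (a < (\<Sum>i<k. fst x i) \<and> (\<forall>j\<in>{..<k}. (\<Sum>i<j. fst x i) \<le> a)) \<and> (\<Sum>i<k. fst x i) + snd x 0 \<le> c}"
  have m1: "(\<lambda>x. \<Sum>i<j. fst x i) \<in> borel_measurable (?P \<Otimes>\<^sub>M ?Q)"
    if "j \<le> k" for j
    by (intro borel_measurable_sum measurable_compose[OF measurable_fst] measurable_component_singleton)
       (use that in auto)
  have m2: "(\<lambda>x. snd x 0) \<in> borel_measurable (?P \<Otimes>\<^sub>M ?Q)"
    by (intro measurable_compose[OF measurable_snd] measurable_component_singleton) auto
  have C: "C \<in> sets (?P \<Otimes>\<^sub>M ?Q)" unfolding C_def
    by (intro sets.sets_Collect_conj sets.sets_Collect_finite_All borel_measurable_less
        borel_measurable_le borel_measurable_const borel_measurable_add m1 m2) auto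
  have pair: "(\<lambda>\<omega>. (V \<omega>, ?c (R \<omega>))) \<in> measurable M (?P \<Otimes>\<^sub>M ?Q)"
    "(\<lambda>\<omega>. (V \<omega>, ?c (- R \<omega>))) \<in> measurable M (?P \<Otimes>\<^sub>M ?Q)"
    by (intro measurable_Pair Vm measurable_restrict; measurable)+
  have VS: "(\<Sum>i<j. V \<omega> i) = S j \<omega>" if "j \<le> k" for j \<omega>
    unfolding S V_def using that by (intro sum.cong) auto
  have Sn: "S n \<omega> = S k \<omega> + R \<omega>" for \<omega>
    unfolding S R_def using \<open>k \<le> n\<close>
    by (metis atLeast0LessThan sum.atLeastLessThan_concat zero_le)
  have spV: "V \<omega> \<in> space ?P" if "\<omega> \<in> space M" for \<omega> using measurable_space[OF Vm that] .
  have "prob ((\<lambda>\<omega>. (V \<omega>, ?c (R \<omega>))) -` C \<inter> space M) = prob ((\<lambda>\<omega>. (V \<omega>, ?c (- R \<omega>))) -` C \<inter> space M)"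
    using arg_cong[OF joint, of "\<lambda>N. measure N C"]
    by (simp only: measure_distr[OF pair(1) C] measure_distr[OF pair(2) C])
  moreover have "(\<lambda>\<omega>. (V \<omega>, ?c (R \<omega>))) -` C \<inter> space M
      = {\<omega> \<in> space M. (a < S k \<omega> \<and> (\<forall>j<k. S j \<omega> \<le> a)) \<and> S n \<omega> \<le> c}"
    using spV by (auto simp: C_def VS Sn space_pair_measure space_PiM)
  moreover have "(\<lambda>\<omega>. (V \<omega>, ?c (- R \<omega>))) -` C \<inter> space M
      = {\<omega> \<in> space M. (a < S k \<omega> \<and> (\<forall>j<k. S j \<omega> \<le> a)) \<and> 2 * S k \<omega> - c \<le> S n \<omega>}"
    using spV by (auto simp: C_def VS Sn space_pair_measure space_PiM)
  ultimately show ?thesis by simp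
qed

text \<open>For a walk, reflection is exact up to the overshoot at the first passage
  \<open>k\<close>. The upper bound uses \<open>a < S k\<close>; the lower one needs
  \<open>S k \<le> a + \<delta>\<close>, which can fail only if some increment exceeds
  \<open>\<delta>\<close>.\<close>

lemma (in prob_space) discrete_reflection:
  fixes \<xi> :: "nat \<Rightarrow> 'a \<Rightarrow> real"
  assumes ind: "indep_vars (\<lambda>_. borel) \<xi> {..<n}"
    and sym: "\<And>i u. i < n \<Longrightarrow> char (distr M borel (\<xi> i)) (- u) = char (distr M borel (\<xi> i)) u"
    and S: "\<And>k \<omega>. S k \<omega> = (\<Sum>i<k. \<xi> i \<omega>)"
    and "0 \<le> a" "c \<le> a" "0 \<le> \<delta>"
  shows "prob {\<omega> \<in> space M. (\<exists>k\<le>n. a < S k \<omega>) \<and> S n \<omega> \<le> c} \<le> prob {\<omega> \<in> space M. 2 * a - c < S n \<omega>}" (is ?upper)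
    and "prob {\<omega> \<in> space M. 2 * a + 2 * \<delta> - c < S n \<omega>}
         \<le> prob {\<omega> \<in> space M. (\<exists>k\<le>n. a < S k \<omega>) \<and> S n \<omega> \<le> c} + prob {\<omega> \<in> space M. \<exists>i<n. \<delta> < \<xi> i \<omega>}" (is ?lower)
proof -
  have \<xi>[measurable]: "\<xi> i \<in> borel_measurable M" if "i < n" for i
    using ind that by (auto simp: indep_vars_def)
  have [measurable]: "S k \<in> borel_measurable M" if "k \<le> n" for k
    unfolding S[abs_def] using that by (intro borel_measurable_sum) auto
  define G where "G = (\<lambda>k \<omega>. a < S k \<omega> \<and> (\<forall>j\<in>{..<k}. S j \<omega> \<le> a))"
  have G[measurable]: "Measurable.pred M (G k)" if "k \<le> n" for k
    unfolding G_def by measurable (use that in auto)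
  have ex: "(\<exists>k\<le>n. a < S k \<omega>) \<longleftrightarrow> (\<exists>k\<le>n. G k \<omega>)" for \<omega>
  proof
    assume "\<exists>k\<le>n. a < S k \<omega>"
    then obtain k where k: "k \<le> n" "a < S k \<omega>" by auto
    define k0 where "k0 = (LEAST k. a < S k \<omega>)"
    have "a < S k0 \<omega>" unfolding k0_def using k(2) by (rule LeastI)
    moreover have "k0 \<le> k" unfolding k0_def using k(2) by (rule Least_le)
    moreover have "S j \<omega> \<le> a" if "j < k0" for j
      using not_less_Least[of j "\<lambda>k. a < S k \<omega>"] that by (simp add: k0_def not_less)
    ultimately show "\<exists>k\<le>n. G k \<omega>" using k(1) by (auto simp: G_def intro!: exI[of _ k0])
  qed (auto simp: G_def)
  have disj: "i = j" if "G i \<omega>" "G j \<omega>" for i j \<omega>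
    using that unfolding G_def by (metis lessThan_iff linorder_less_linear not_less)
  have disjf: "disjoint_family_on (\<lambda>k. {\<omega> \<in> space M. G k \<omega> \<and> P k \<omega>}) {..n}" for P
    using disj by (auto simp: disjoint_family_on_def)
  have E: "prob {\<omega> \<in> space M. (\<exists>k\<le>n. a < S k \<omega>) \<and> S n \<omega> \<le> c} = prob (\<Union>k\<in>{..n}. {\<omega> \<in> space M. G k \<omega> \<and> 2 * S k \<omega> - c \<le> S n \<omega>})"
  proof -
    have "{\<omega> \<in> space M. (\<exists>k\<le>n. a < S k \<omega>) \<and> S n \<omega> \<le> c} = (\<Union>k\<in>{..n}. {\<omega> \<in> space M. G k \<omega> \<and> S n \<omega> \<le> c})"
      unfolding ex by auto
    also have "prob \<dots> = (\<Sum>k\<in>{..n}. prob {\<omega> \<in> space M. G k \<omega> \<and> S n \<omega> \<le> c})"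
      by (rule finite_measure_finite_Union) (use disjf in auto)
    also have "\<dots> = (\<Sum>k\<in>{..n}. prob {\<omega> \<in> space M. G k \<omega> \<and> 2 * S k \<omega> - c \<le> S n \<omega>})"
    proof (rule sum.cong)
      fix k assume "k \<in> {..n}"
      then have "k \<le> n" by simp
      from reflect_increment[OF ind sym this S, of a c]
      show "prob {\<omega> \<in> space M. G k \<omega> \<and> S n \<omega> \<le> c} = prob {\<omega> \<in> space M. G k \<omega> \<and> 2 * S k \<omega> - c \<le> S n \<omega>}"
        by (simp only: G_def Ball_def lessThan_iff)
    qed simp
    also have "\<dots> = prob (\<Union>k\<in>{..n}. {\<omega> \<in> space M. G k \<omega> \<and> 2 * S k \<omega> - c \<le> S n \<omega>})"
      by (rule finite_measure_finite_Union[symmetric]) (use disjf in auto)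
    finally show ?thesis .
  qed
  show ?upper unfolding E
    by (rule finite_measure_mono) (auto simp: G_def)
  have "{\<omega> \<in> space M. 2 * a + 2 * \<delta> - c < S n \<omega>}
      \<subseteq> (\<Union>k\<in>{..n}. {\<omega> \<in> space M. G k \<omega> \<and> 2 * S k \<omega> - c \<le> S n \<omega>}) \<union> {\<omega> \<in> space M. \<exists>i\<in>{..<n}. \<delta> < \<xi> i \<omega>}"
  proof
    fix \<omega> assume w: "\<omega> \<in> {\<omega> \<in> space M. 2 * a + 2 * \<delta> - c < S n \<omega>}"
    \<comment> \<open>\<open>c \<le> a\<close> puts \<open>2 * a + 2 * \<delta> - c\<close> at or
      above \<open>a\<close>, so there is a first passage; it is not at \<open>k = 0\<close> because
      \<open>S 0 \<omega> = 0 \<le> a\<close>.\<close>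
    then have "a < S n \<omega>" using assms by auto
    then obtain k where k: "k \<le> n" "G k \<omega>" using ex by blast
    have "k \<noteq> 0" by (rule notI) (use k(2) \<open>0 \<le> a\<close> in \<open>auto simp: G_def S\<close>)
    then obtain j where j: "k = Suc j" using not0_implies_Suc by auto
    then have "S k \<omega> = S j \<omega> + \<xi> j \<omega>" "S j \<omega> \<le> a" using k(2) by (auto simp: S G_def)
    then show "\<omega> \<in> (\<Union>k\<in>{..n}. {\<omega> \<in> space M. G k \<omega> \<and> 2 * S k \<omega> - c \<le> S n \<omega>}) \<union> {\<omega> \<in> space M. \<exists>i\<in>{..<n}. \<delta> < \<xi> i \<omega>}"
    proof (cases "\<delta> < \<xi> j \<omega>")
      case True
      then show ?thesis using w k j by (auto intro!: bexI[of _ j])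
    next
      case False
      then have "2 * S k \<omega> - c \<le> S n \<omega>" using w \<open>S k \<omega> = S j \<omega> + \<xi> j \<omega>\<close> \<open>S j \<omega> \<le> a\<close> by auto
      then show ?thesis using w k by blast
    qed
  qed
  then have "prob {\<omega> \<in> space M. 2 * a + 2 * \<delta> - c < S n \<omega>}
    \<le> prob ((\<Union>k\<in>{..n}. {\<omega> \<in> space M. G k \<omega> \<and> 2 * S k \<omega> - c \<le> S n \<omega>}) \<union> {\<omega> \<in> space M. \<exists>i\<in>{..<n}. \<delta> < \<xi> i \<omega>})"
    by (rule finite_measure_mono) auto
  also have "\<dots> \<le> prob (\<Union>k\<in>{..n}. {\<omega> \<in> space M. G k \<omega> \<and> 2 * S k \<omega> - c \<le> S n \<omega>}) + prob {\<omega> \<in> space M. \<exists>i\<in>{..<n}. \<delta> < \<xi> i \<omega>}"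
    by (rule measure_Un_le) auto
  finally show ?lower unfolding E by (simp only: Bex_def lessThan_iff)
qed

text \<open>The interval is cut into \<open>n\<close> equal pieces; as \<open>n\<close> grows, continuity of the paths makes the
  overshoot of the discrete walk over the level vanish.\<close>

lemma (in prob_space) continuous_reflection:
  fixes B :: "real \<Rightarrow> 'a \<Rightarrow> real" and t a c :: real
  assumes t: "0 < t"
    and cont: "\<And>\<omega>. \<omega> \<in> space M \<Longrightarrow> continuous_on {0..t} (\<lambda>s. B s \<omega>)"
    and B0: "\<And>\<omega>. \<omega> \<in> space M \<Longrightarrow> B 0 \<omega> = 0"
    and Bm: "\<And>s. s \<in> {0..t} \<Longrightarrow> B s \<in> borel_measurable M"
    and ind: "\<And>n::nat. 0 < n \<Longrightarrow>
       indep_vars (\<lambda>_. borel) (\<lambda>i \<omega>. B (t * Suc i / n) \<omega> - B (t * i / n) \<omega>) {..<n}"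
    and sym: "\<And>n i u. i < n \<Longrightarrow>
       char (distr M borel (\<lambda>\<omega>. B (t * Suc i / real n) \<omega> - B (t * real i / real n) \<omega>)) (- u)
     = char (distr M borel (\<lambda>\<omega>. B (t * Suc i / real n) \<omega> - B (t * real i / real n) \<omega>)) u"
    and a: "0 \<le> a" "c \<le> a"
  shows "{\<omega> \<in> space M. (\<exists>s\<in>{0..t}. a < B s \<omega>) \<and> B t \<omega> \<le> c} \<in> events"
    and "prob {\<omega> \<in> space M. (\<exists>s\<in>{0..t}. a < B s \<omega>) \<and> B t \<omega> \<le> c} = prob {\<omega> \<in> space M. 2 * a - c < B t \<omega>}"
proof -
  define E where "E = {\<omega> \<in> space M. (\<exists>s\<in>{0..t}. a < B s \<omega>) \<and> B t \<omega> \<le> c}"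
  define En where "En = (\<lambda>n::nat. {\<omega> \<in> space M. (\<exists>k\<in>{..n}. a < B (t * real k / real n) \<omega>) \<and> B t \<omega> \<le> c})"
  define Ov where "Ov = (\<lambda>\<delta> (n::nat). {\<omega> \<in> space M. \<exists>i\<in>{..<n}. \<delta> < B (t * real (Suc i) / real n) \<omega> - B (t * real i / real n) \<omega>})"
  \<comment> \<open>For \<open>n = 0\<close> the quotient is \<open>0\<close>, which is still a
    point of \<open>{0..t}\<close>.\<close>
  have grid: "t * real k / real n \<in> {0..t}" if "k \<le> n" for k n :: nat
    using that t by (cases "n = 0") (auto simp: field_simps)
  have [measurable]: "B (t * real k / real n) \<in> borel_measurable M" if "k \<le> n" for k n :: nat
    using Bm grid[OF that] by blast
  have Btm[measurable]: "B t \<in> borel_measurable M" using Bm t by auto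
  have Enm[measurable]: "En n \<in> events" for n unfolding En_def by measurable
  have Om[measurable]: "Ov \<delta> n \<in> events" for n \<delta>
    unfolding Ov_def by (measurable; auto simp: Suc_le_eq)
  have EnE: "(\<lambda>n. indicator (En n) \<omega> :: real) \<longlonglongrightarrow> indicator E \<omega>" if w: "\<omega> \<in> space M" for \<omega>
  proof (cases "\<omega> \<in> E")
    case True
    then obtain s where s: "s \<in> {0..t}" "a < B s \<omega>" and c: "B t \<omega> \<le> c" by (auto simp: E_def)
    \<comment> \<open>Round \<open>s\<close> down to the grid of mesh \<open>t / n\<close>; by
      continuity the path is above \<open>a\<close> at that grid point for all large
      \<open>n\<close>.\<close>
    define g where "g = (\<lambda>n::nat. t * real (nat \<lfloor>s * real n / t\<rfloor>) / real n)"
    have fl: "nat \<lfloor>s * real n / t\<rfloor> \<le> n" for n :: nat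
    proof -
      have "s * real n / t \<le> real n" using s t by (auto simp: field_simps mult_mono)
      then show ?thesis by linarith
    qed
    have g_in: "g n \<in> {0..t}" for n unfolding g_def by (rule grid[OF fl])
    have "g \<longlonglongrightarrow> s"
    proof (rule tendsto_sandwich[of "\<lambda>n. s - t / real n" _ _ "\<lambda>n. s"])
      show "\<forall>\<^sub>F n in sequentially. s - t / real n \<le> g n"
      proof (rule eventually_sequentiallyI[of 1])
        fix n :: nat assume n: "1 \<le> n"
        have "s * real n / t - 1 \<le> real (nat \<lfloor>s * real n / t\<rfloor>)" by linarith
        then have "t * (s * real n / t - 1) / real n \<le> g n"
          unfolding g_def using t n by (intro divide_right_mono mult_left_mono) auto
        moreover have "t * (s * real n / t - 1) / real n = s - t / real n"
          using t n by (simp add: field_simps)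
        ultimately show "s - t / real n \<le> g n" by simp
      qed
      show "\<forall>\<^sub>F n in sequentially. g n \<le> s"
      proof (rule eventually_sequentiallyI[of 1])
        fix n :: nat assume n: "1 \<le> n"
        have "0 \<le> s * real n / t" using s t by auto
        then have "real (nat \<lfloor>s * real n / t\<rfloor>) \<le> s * real n / t" by linarith
        then have "g n \<le> t * (s * real n / t) / real n"
          unfolding g_def using t n by (intro divide_right_mono mult_left_mono) auto
        then show "g n \<le> s" using t n by (simp add: field_simps)
      qed
      show "(\<lambda>n. s - t / real n) \<longlonglongrightarrow> s" by real_asymp
    qed simp
    then have "(\<lambda>n. B (g n) \<omega>) \<longlonglongrightarrow> B s \<omega>"
      using cont[OF w] s(1) g_in by (auto simp: continuous_on_sequentially comp_def)
    then have "\<forall>\<^sub>F n in sequentially. a < B (g n) \<omega>" using s(2) by (rule order_tendstoD)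
    then have "\<forall>\<^sub>F n in sequentially. \<omega> \<in> En n"
    proof eventually_elim
      case (elim n)
      then show ?case unfolding En_def g_def using w c fl[of n] by blast
    qed
    then have "\<forall>\<^sub>F n in sequentially. indicator (En n) \<omega> = (indicator E \<omega> :: real)"
      by eventually_elim (use True in auto)
    then show ?thesis by (rule tendsto_eventually)
  next
    case False
    then have "\<omega> \<notin> En n" for n unfolding E_def En_def using grid by blast
    then show ?thesis using False by simp
  qed
  \<comment> \<open>The event quantifies over uncountably many times; it is measurable as a
    pointwise limit of events that involve finitely many.\<close>
  have Em[measurable]: "E \<in> events"
  proof -
    have "(indicator E :: 'a \<Rightarrow> real) \<in> borel_measurable M"
      by (rule borel_measurable_LIMSEQ_real[OF EnE]) auto
    moreover have "E \<subseteq> space M" by (auto simp: E_def)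
    ultimately show ?thesis by (simp add: borel_measurable_indicator_iff Int_absorb2)
  qed
  \<comment> \<open>Uniform continuity on the compact interval: once the mesh is small enough for
    \<open>\<delta>\<close>, no increment exceeds \<open>\<delta>\<close>.\<close>
  have O0: "(\<lambda>n. indicator (Ov \<delta> n) \<omega> :: real) \<longlonglongrightarrow> 0" if w: "\<omega> \<in> space M" and \<delta>: "0 < \<delta>" for \<omega> \<delta>
  proof -
    have "uniformly_continuous_on {0..t} (\<lambda>s. B s \<omega>)"
      by (rule compact_uniformly_continuous[OF cont[OF w]]) auto
    then obtain d where d: "0 < d"
      and dd: "\<And>x y. x \<in> {0..t} \<Longrightarrow> y \<in> {0..t} \<Longrightarrow> dist y x < d \<Longrightarrow> dist (B y \<omega>) (B x \<omega>) < \<delta>"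
      using \<delta> unfolding uniformly_continuous_on_def by metis
    have "(\<lambda>n. t / real n) \<longlonglongrightarrow> 0" by real_asymp
    then have "\<forall>\<^sub>F n in sequentially. t / real n < d" using d by (rule order_tendstoD)
    then have "\<forall>\<^sub>F n in sequentially. \<omega> \<notin> Ov \<delta> n"
    proof eventually_elim
      case (elim n)
      have "\<not> \<delta> < B (t * real (Suc i) / real n) \<omega> - B (t * real i / real n) \<omega>" if "i < n" for i
      proof -
        have "t * real (Suc i) / real n - t * real i / real n = t / real n"
          by (simp add: distrib_left add_divide_distrib)
        then have "dist (t * real (Suc i) / real n) (t * real i / real n) < d"
          using elim t by (simp add: dist_real_def)
        from dd[OF grid grid this] that show ?thesis by (auto simp: dist_real_def)
      qed
      then show ?case by (auto simp: Ov_def)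
    qed
    then have "\<forall>\<^sub>F n in sequentially. indicator (Ov \<delta> n) \<omega> = (0 :: real)"
      by eventually_elim auto
    then show ?thesis by (rule tendsto_eventually)
  qed
  have prob_lim: "(\<lambda>n. prob (F n)) \<longlonglongrightarrow> prob G"
    if "\<And>n. F n \<in> events" "G \<in> events"
      and "\<And>\<omega>. \<omega> \<in> space M \<Longrightarrow> (\<lambda>n. indicator (F n) \<omega> :: real) \<longlonglongrightarrow> indicator G \<omega>" for F G
  proof -
    have "(\<lambda>n. LINT \<omega>|M. indicator (F n) \<omega> :: real) \<longlonglongrightarrow> (LINT \<omega>|M. indicator G \<omega>)"
      by (rule integral_dominated_convergence[where w="\<lambda>_. 1"]) (use that in \<open>auto simp: indicator_def\<close>)
    then show ?thesis using that by (simp add: Int_absorb2 sets.sets_into_space)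
  qed
  have limE: "(\<lambda>n. prob (En n)) \<longlonglongrightarrow> prob E" by (rule prob_lim) (use EnE in auto)
  have limO: "(\<lambda>n. prob (Ov \<delta> n)) \<longlonglongrightarrow> 0" if "0 < \<delta>" for \<delta>
    using prob_lim[of "Ov \<delta>" "{}"] O0[OF _ that] by auto
  have discrete: "prob (En n) \<le> prob {\<omega> \<in> space M. 2 * a - c < B t \<omega>}"
    "0 \<le> \<delta> \<Longrightarrow> prob {\<omega> \<in> space M. 2 * a + 2 * \<delta> - c < B t \<omega>} \<le> prob (En n) + prob (Ov \<delta> n)"
    if "0 < n" for n \<delta>
  proof -
    define \<xi> where "\<xi> = (\<lambda>i \<omega>. B (t * real (Suc i) / real n) \<omega> - B (t * real i / real n) \<omega>)"
    define S where "S = (\<lambda>k \<omega>. \<Sum>i<k. \<xi> i \<omega>)"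
    have SB: "S k \<omega> = B (t * real k / real n) \<omega>" if "\<omega> \<in> space M" for k \<omega>
      unfolding S_def \<xi>_def using B0[OF that] sum_lessThan_telescope[of "\<lambda>i. B (t * real i / real n) \<omega>" k] by simp
    have SnB: "S n \<omega> = B t \<omega>" if "\<omega> \<in> space M" for \<omega> using SB[OF that] \<open>0 < n\<close> by simp
    have 1: "indep_vars (\<lambda>_. borel) \<xi> {..<n}" unfolding \<xi>_def by (rule ind[OF that])
    have 2: "char (distr M borel (\<xi> i)) (- u) = char (distr M borel (\<xi> i)) u" if "i < n" for i u
      unfolding \<xi>_def by (rule sym[OF that])
    have e1: "{\<omega> \<in> space M. (\<exists>k\<le>n. a < S k \<omega>) \<and> S n \<omega> \<le> c} = En n"
      unfolding En_def using SB SnB by auto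
    have e2: "{\<omega> \<in> space M. \<exists>i<n. \<delta> < \<xi> i \<omega>} = Ov \<delta> n" unfolding Ov_def \<xi>_def by auto
    have e3: "{\<omega> \<in> space M. x < S n \<omega>} = {\<omega> \<in> space M. x < B t \<omega>}" for x using SnB by auto
    note D = discrete_reflection[OF 1 2, of S a c, unfolded e1 e2 e3, OF _ _ a]
    show "prob (En n) \<le> prob {\<omega> \<in> space M. 2 * a - c < B t \<omega>}"
      using D(1)[of 0] by (simp add: S_def)
    show "prob {\<omega> \<in> space M. 2 * a + 2 * \<delta> - c < B t \<omega>} \<le> prob (En n) + prob (Ov \<delta> n)" if "0 \<le> \<delta>"
      using D(2)[of \<delta>] that by (simp add: S_def e2)
  qed
  have up: "prob E \<le> prob {\<omega> \<in> space M. 2 * a - c < B t \<omega>}"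
    by (rule LIMSEQ_le_const2[OF limE]) (use discrete(1) in \<open>auto intro!: exI[of _ 1]\<close>)
  have lo: "prob {\<omega> \<in> space M. 2 * a + 2 * \<delta> - c < B t \<omega>} \<le> prob E" if "0 < \<delta>" for \<delta>
  proof (rule LIMSEQ_le_const)
    show "(\<lambda>n. prob (En n) + prob (Ov \<delta> n)) \<longlonglongrightarrow> prob E" using tendsto_add[OF limE limO[OF that]] by simp
  qed (use discrete(2)[of _ \<delta>] that in \<open>auto intro!: exI[of _ 1]\<close>)
  \<comment> \<open>The overshoot bound shrinks along \<open>1 / Suc n\<close>. With strict
    inequalities these events increase to the limit event, so atoms of the law of \<open>B t\<close>
    do no harm.\<close>
  have "(\<lambda>n. prob {\<omega> \<in> space M. 2 * a + 2 * (1 / real (Suc n)) - c < B t \<omega>}) \<longlonglongrightarrow> prob {\<omega> \<in> space M. 2 * a - c < B t \<omega>}"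
  proof (rule prob_lim)
    fix \<omega> assume "\<omega> \<in> space M"
    show "(\<lambda>n. indicator {\<omega> \<in> space M. 2 * a + 2 * (1 / real (Suc n)) - c < B t \<omega>} \<omega> :: real)
      \<longlonglongrightarrow> indicator {\<omega> \<in> space M. 2 * a - c < B t \<omega>} \<omega>"
    proof (cases "2 * a - c < B t \<omega>")
      case True
      have "(\<lambda>n. 2 * a + 2 * (1 / real (Suc n)) - c) \<longlonglongrightarrow> 2 * a - c" by real_asymp
      then have "\<forall>\<^sub>F n in sequentially. 2 * a + 2 * (1 / real (Suc n)) - c < B t \<omega>"
        using True by (rule order_tendstoD)
      then have "\<forall>\<^sub>F n in sequentially. indicator {\<omega> \<in> space M. 2 * a + 2 * (1 / real (Suc n)) - c < B t \<omega>} \<omega>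
         = (indicator {\<omega> \<in> space M. 2 * a - c < B t \<omega>} \<omega> :: real)"
        by eventually_elim (use True \<open>\<omega> \<in> space M\<close> in auto)
      then show ?thesis by (rule tendsto_eventually)
    next
      case False
      then have "\<not> 2 * a + 2 * (1 / real (Suc n)) - c < B t \<omega>" for n
        using divide_nonneg_nonneg[of 1 "real (Suc n)"] by linarith
      then show ?thesis using False by (simp add: indicator_def)
    qed
  qed measurable
  then have "prob {\<omega> \<in> space M. 2 * a - c < B t \<omega>} \<le> prob E"
    by (rule LIMSEQ_le_const2) (intro exI allI impI lo, simp)
  with up show "prob {\<omega> \<in> space M. (\<exists>s\<in>{0..t}. a < B s \<omega>) \<and> B t \<omega> \<le> c} = prob {\<omega> \<in> space M. 2 * a - c < B t \<omega>}"
    unfolding E_def by simp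
  show "{\<omega> \<in> space M. (\<exists>s\<in>{0..t}. a < B s \<omega>) \<and> B t \<omega> \<le> c} \<in> events" using Em unfolding E_def .
qed

subsection \<open>Gaussian variables and the error function\<close>

lemma (in prob_space) char_centered_normal:
  assumes D: "distributed M lborel Y (normal_density 0 \<sigma>)" and s: "0 < \<sigma>"
  shows "char (distr M borel Y) u = exp (- (u\<^sup>2 * \<sigma>\<^sup>2) / 2)"
proof -
  have [measurable]: "Y \<in> borel_measurable M" using distributed_measurable[OF D] by simp
  have "distributed M lborel (\<lambda>\<omega>. Y \<omega> / \<sigma>) std_normal_density"
    using D normal_standard_normal_convert[OF s, of Y 0] by simp
  then have std: "distr M lborel (\<lambda>\<omega>. Y \<omega> / \<sigma>) = std_normal_distribution"
    by (rule distributed_distr_eq_density)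
  have "char (distr M borel Y) u = char (distr M lborel (\<lambda>\<omega>. Y \<omega> / \<sigma>)) (u * \<sigma>)"
    unfolding char_def using s by (simp add: integral_distr)
  also have "\<dots> = exp (- (u\<^sup>2 * \<sigma>\<^sup>2) / 2)"
    unfolding std char_std_normal_distribution by (simp add: power_mult_distrib)
  finally show ?thesis .
qed

text \<open>Writing the characteristic function with the second moment lets one formula cover the
  normal and the degenerate case; mean \<open>0\<close> forces a point mass to sit at
  \<open>0\<close>.\<close>

lemma (in prob_space) gaussian_rv_centered:
  assumes "gaussian_rv M Y" and mean: "expectation Y = 0"
  shows gaussian_rv_square_integrable: "integrable M (\<lambda>\<omega>. (Y \<omega>)\<^sup>2)"
    and gaussian_rv_integrable: "integrable M Y"
    and gaussian_rv_char: "char (distr M borel Y) u = exp (- (u\<^sup>2 * expectation (\<lambda>\<omega>. (Y \<omega>)\<^sup>2)) / 2)"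
proof -
  have Ym[measurable]: "Y \<in> borel_measurable M" using assms by (simp add: gaussian_rv_def)
  have "integrable M (\<lambda>\<omega>. (Y \<omega>)\<^sup>2) \<and> integrable M Y \<and>
      char (distr M borel Y) u = exp (- (u\<^sup>2 * expectation (\<lambda>\<omega>. (Y \<omega>)\<^sup>2)) / 2)"
  proof -
    from assms(1) consider (normal) \<mu> \<sigma> where "0 < \<sigma>" "distributed M lborel Y (normal_density \<mu> \<sigma>)"
      | (const) \<mu> where "AE \<omega> in M. Y \<omega> = \<mu>"
      unfolding gaussian_rv_def by blast
    then show ?thesis
    proof cases
      case normal
      note D = normal(2) and s = normal(1)
      have \<mu>: "\<mu> = 0" using normal_distributed_expectation[OF s D] mean by simp
      have v: "expectation (\<lambda>\<omega>. (Y \<omega>)\<^sup>2) = \<sigma>\<^sup>2"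
        using normal_distributed_variance[OF s D] mean by simp
      have i2: "integrable M (\<lambda>\<omega>. (Y \<omega>)\<^sup>2)"
        using integrable_normal_moment[OF s, of 0 2] D \<mu>
        by (subst distributed_integrable[OF D, symmetric]) auto
      have i1: "integrable M Y"
        using integrable_normal_moment[OF s, of 0 1] D \<mu>
        by (subst distributed_integrable[OF D, symmetric]) auto
      show ?thesis using i1 i2 v char_centered_normal[of Y \<sigma> u] D s \<mu> by simp
    next
      case const
      have "expectation Y = \<mu>" using const by (subst integral_cong_AE[of _ _ "\<lambda>_. \<mu>"]) (auto simp: prob_space)
      with const mean have ae: "AE \<omega> in M. Y \<omega> = 0" by simp
      have "expectation (\<lambda>\<omega>. (Y \<omega>)\<^sup>2) = expectation (\<lambda>_. 0)"
        using ae by (intro integral_cong_AE) auto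
      moreover have "expectation (\<lambda>\<omega>. iexp (u * Y \<omega>)) = expectation (\<lambda>\<omega>. 1)"
        using ae by (intro integral_cong_AE) auto
      then have "char (distr M borel Y) u = expectation (\<lambda>\<omega>. 1)"
        unfolding char_def by (subst integral_distr) auto
      moreover have "integrable M (\<lambda>\<omega>. (Y \<omega>)\<^sup>2) \<longleftrightarrow> integrable M (\<lambda>\<omega>. 0 :: real)"
        using ae by (intro integrable_cong_AE) auto
      moreover have "integrable M Y \<longleftrightarrow> integrable M (\<lambda>\<omega>. 0 :: real)"
        using ae by (intro integrable_cong_AE) auto
      ultimately show ?thesis by (simp add: prob_space)
    qed
  qed
  then show "integrable M (\<lambda>\<omega>. (Y \<omega>)\<^sup>2)" "integrable M Y"
    "char (distr M borel Y) u = exp (- (u\<^sup>2 * expectation (\<lambda>\<omega>. (Y \<omega>)\<^sup>2)) / 2)" by auto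
qed

lemma (in prob_space) gaussian_rv_distributed:
  assumes G: "gaussian_rv M Y" and mean: "expectation Y = 0"
    and var: "expectation (\<lambda>\<omega>. (Y \<omega>)\<^sup>2) = \<sigma>\<^sup>2" and s: "0 < \<sigma>"
  shows "distributed M lborel Y (normal_density 0 \<sigma>)"
proof -
  have Ym[measurable]: "Y \<in> borel_measurable M" using G by (simp add: gaussian_rv_def)
  from G consider (normal) \<mu> \<sigma>' where "0 < \<sigma>'" "distributed M lborel Y (normal_density \<mu> \<sigma>')"
    | (const) \<mu> where "AE \<omega> in M. Y \<omega> = \<mu>"
    unfolding gaussian_rv_def by blast
  then show ?thesis
  proof cases
    case normal
    have "\<mu> = 0" using normal_distributed_expectation[OF normal] mean by simp
    moreover have "\<sigma>'\<^sup>2 = \<sigma>\<^sup>2" using normal_distributed_variance[OF normal] mean var by simp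
    then have "\<sigma>' = \<sigma>" using s normal(1) by (simp add: power2_eq_iff_nonneg)
    ultimately show ?thesis using normal by simp
  next
    case const
    have "expectation Y = \<mu>" using const by (subst integral_cong_AE[of _ _ "\<lambda>_. \<mu>"]) (auto simp: prob_space)
    with const mean have "AE \<omega> in M. Y \<omega> = 0" by simp
    then have "expectation (\<lambda>\<omega>. (Y \<omega>)\<^sup>2) = expectation (\<lambda>_. 0)" by (intro integral_cong_AE) auto
    with var s show ?thesis by simp
  qed
qed

lemma integrable_mult_of_squares:
  fixes f g :: "'a \<Rightarrow> real"
  assumes [measurable]: "f \<in> borel_measurable M" "g \<in> borel_measurable M"
    and "integrable M (\<lambda>x. (f x)\<^sup>2)" "integrable M (\<lambda>x. (g x)\<^sup>2)"
  shows "integrable M (\<lambda>x. f x * g x)"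
proof (rule Bochner_Integration.integrable_bound[OF Bochner_Integration.integrable_add[OF assms(3,4)]])
  have "\<bar>a * b\<bar> \<le> a\<^sup>2 + b\<^sup>2" for a b :: real
    proof -
    have "2 * (\<bar>a\<bar> * \<bar>b\<bar>) \<le> a\<^sup>2 + b\<^sup>2"
      using sum_squares_bound[of "\<bar>a\<bar>" "\<bar>b\<bar>"] by (simp add: mult.assoc)
    moreover have "0 \<le> \<bar>a\<bar> * \<bar>b\<bar>" by simp
    ultimately show ?thesis unfolding abs_mult by linarith
  qed
  then show "AE x in M. norm (f x * g x) \<le> norm ((f x)\<^sup>2 + (g x)\<^sup>2)" by simp
qed simp

section \<open>Gaussian integrals in terms of the error function\<close>

lemma integrable_exp_neg_square: "integrable lborel (\<lambda>u::real. exp (- u\<^sup>2))"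
  and integral_exp_neg_square_atMost_0: "(LBINT u:{..0}. exp (- u\<^sup>2)) = sqrt pi / 2"
proof -
  have pos: "has_bochner_integral lborel (\<lambda>x::real. indicator {0..} x *\<^sub>R exp (- x\<^sup>2)) (sqrt pi / 2)"
    by (rule gaussian_moment_0)
  have neg: "has_bochner_integral lborel (\<lambda>x::real. indicator {..0} x *\<^sub>R exp (- x\<^sup>2)) (sqrt pi / 2)"
    using lborel_has_bochner_integral_real_affine_iff[of "-1" "\<lambda>x. indicator {..0} x *\<^sub>R exp (- x\<^sup>2)" "sqrt pi / 2" 0] pos
    by (simp add: indicator_def)
  then show "(LBINT u:{..0}. exp (- u\<^sup>2)) = sqrt pi / 2"
    unfolding set_lebesgue_integral_def by (rule has_bochner_integral_integral_eq)
  have "integrable lborel (\<lambda>x::real. indicator {0..} x *\<^sub>R exp (- x\<^sup>2) + indicator {..0} x *\<^sub>R exp (- x\<^sup>2))"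
    using pos neg by (intro Bochner_Integration.integrable_add) (auto dest: has_bochner_integral_integrable simp: integrable.simps)
  then show "integrable lborel (\<lambda>u::real. exp (- u\<^sup>2))"
    by (rule Bochner_Integration.integrable_bound) (auto simp: indicator_def)
qed

text \<open>Starting from the half line \<open>{..0}\<close>, the signed integral in
  \<open>erf\<close> adds the piece \<open>{0<..z}\<close> or removes the piece
  \<open>{z<..0}\<close>, hence the two cases.\<close>

lemma integral_exp_neg_square_atMost:
  "(LBINT u:{..z}. exp (- u\<^sup>2)) = sqrt pi / 2 * (1 + erf z)"
proof -
  have I: "set_integrable lborel A (\<lambda>u::real. exp (- u\<^sup>2))" if "A \<in> sets borel" for A
    using integrable_exp_neg_square that unfolding set_integrable_def
    by (intro integrable_mult_indicator) auto
  have E: "sqrt pi / 2 * erf z = (LBINT u=ereal 0..ereal z. exp (- u\<^sup>2))"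
    by (simp add: erf_def zero_ereal_def)
  show ?thesis
  proof (cases "0 \<le> z")
    case True
    have "{..z} = {..0} \<union> {0<..z}" using True by auto
    then have "(LBINT u:{..z}. exp (- u\<^sup>2)) = (LBINT u:{..0}. exp (- u\<^sup>2)) + (LBINT u:{0<..z}. exp (- u\<^sup>2))"
      using I by (simp only:) (rule set_integral_Un, auto)
    also have "(LBINT u:{0<..z}. exp (- u\<^sup>2)) = sqrt pi / 2 * erf z"
      unfolding E by (rule interval_integral_Ioc[OF True, symmetric])
    finally show ?thesis by (simp add: integral_exp_neg_square_atMost_0 algebra_simps)
  next
    case False
    then have z: "z \<le> 0" by simp
    then have "{..0} = {..z} \<union> {z<..0}" by auto
    then have "(LBINT u:{..0}. exp (- u\<^sup>2)) = (LBINT u:{..z}. exp (- u\<^sup>2)) + (LBINT u:{z<..0}. exp (- u\<^sup>2))"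
      using I by (simp only:) (rule set_integral_Un, auto)
    also have "(LBINT u:{z<..0}. exp (- u\<^sup>2)) = - (sqrt pi / 2 * erf z)"
      unfolding E by (subst interval_integral_endpoints_reverse) (simp add: interval_integral_Ioc[OF z])
    finally show ?thesis by (simp add: integral_exp_neg_square_atMost_0 algebra_simps)
  qed
qed

lemma erf_minus: "erf (- x) = - erf x"
proof -
  have "(LBINT u=0..ereal (- x). exp (- u\<^sup>2)) = (LBINT u=ereal x..0. exp (- u\<^sup>2))"
    by (subst interval_integral_reflect) simp
  also have "\<dots> = - (LBINT u=0..ereal x. exp (- u\<^sup>2))"
    by (rule interval_integral_endpoints_reverse)
  finally show ?thesis by (simp add: erf_def)
qed

lemma isCont_erf: "isCont erf x"
proof -
  \<comment> \<open>The interval has both \<open>x\<close> and the base point \<open>0\<close> of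
    the integral in its interior.\<close>
  let ?a = "- \<bar>x\<bar> - 1" and ?b = "\<bar>x\<bar> + 1"
  have "((\<lambda>u. LBINT y=ereal 0..ereal u. exp (- y\<^sup>2)) has_vector_derivative exp (- x\<^sup>2)) (at x within {?a..?b})"
    by (rule interval_integral_FTC2) (auto intro!: continuous_intros)
  then have "continuous (at x within {?a..?b}) (\<lambda>u. LBINT y=ereal 0..ereal u. exp (- y\<^sup>2))"
    by (rule has_vector_derivative_continuous)
  moreover have "x \<in> interior {?a..?b}" unfolding interior_atLeastAtMost_real by auto
  ultimately have "isCont (\<lambda>u. LBINT y=ereal 0..ereal u. exp (- y\<^sup>2)) x"
    by (metis at_within_interior)
  then have "isCont (\<lambda>u. 2 / sqrt pi * (LBINT y=ereal 0..ereal u. exp (- y\<^sup>2))) x"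
    by (intro continuous_intros)
  then show ?thesis by (simp add: erf_def[abs_def] zero_ereal_def)
qed

lemma integral_normal_density_atMost:
  assumes s: "0 < \<sigma>"
  shows "(LBINT x:{..c}. normal_density m \<sigma> x) = (1 + erf ((c - m) / (\<sigma> * sqrt 2))) / 2"
proof -
  \<comment> \<open>The substitution \<open>x = m + ?k * u\<close> turns the normal density into
    \<open>exp (- u\<^sup>2) / sqrt pi\<close>.\<close>
  let ?k = "\<sigma> * sqrt 2"
  have k: "0 < ?k" using s by simp
  have dens: "?k * normal_density m \<sigma> (m + ?k * u) = exp (- u\<^sup>2) / sqrt pi" for u
    using s by (simp add: normal_density_def real_sqrt_mult power_mult_distrib field_simps)
  have ind: "indicator {..c} (m + ?k * u) = (indicator {..(c - m) / ?k} u :: real)" for u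
    using k by (auto simp: indicator_def field_simps)
  have "(LBINT x:{..c}. normal_density m \<sigma> x) = \<bar>?k\<bar> *\<^sub>R (LBINT u. indicator {..c} (m + ?k * u) *\<^sub>R normal_density m \<sigma> (m + ?k * u))"
    unfolding set_lebesgue_integral_def
    by (rule lborel_integral_real_affine) (use s in simp)
  also have "\<dots> = (LBINT u. indicator {..(c - m) / ?k} u *\<^sub>R (?k * normal_density m \<sigma> (m + ?k * u)))"
    unfolding ind using k s by (simp flip: Bochner_Integration.integral_mult_right_zero add: mult_ac)
  also have "\<dots> = (LBINT u:{..(c - m) / ?k}. exp (- u\<^sup>2)) / sqrt pi"
    unfolding dens set_lebesgue_integral_def by simp
  also have "\<dots> = (1 + erf ((c - m) / ?k)) / 2"
    unfolding integral_exp_neg_square_atMost by simp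
  finally show ?thesis .
qed

lemma nn_integral_normal_density_atMost:
  assumes s: "0 < \<sigma>"
  shows "(\<integral>\<^sup>+x. ennreal (indicator {..c} x * normal_density m \<sigma> x) \<partial>lborel)
       = ennreal ((1 + erf ((c - m) / (\<sigma> * sqrt 2))) / 2)"
    and erf_normal_nonneg: "0 \<le> (1 + erf ((c - m) / (\<sigma> * sqrt 2))) / 2"
proof -
  have "integrable lborel (\<lambda>x. indicator {..c} x * normal_density m \<sigma> x)"
    using integrable_mult_indicator[of "{..c}" lborel "normal_density m \<sigma>"] s by simp
  then show "(\<integral>\<^sup>+x. ennreal (indicator {..c} x * normal_density m \<sigma> x) \<partial>lborel)
       = ennreal ((1 + erf ((c - m) / (\<sigma> * sqrt 2))) / 2)"
    unfolding integral_normal_density_atMost[OF s, symmetric] set_lebesgue_integral_def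
    by (subst nn_integral_eq_integral) auto
  show "0 \<le> (1 + erf ((c - m) / (\<sigma> * sqrt 2))) / 2"
    unfolding integral_normal_density_atMost[OF s, symmetric] set_lebesgue_integral_def
    by (intro Bochner_Integration.integral_nonneg) auto
qed

text \<open>Completing the square: an exponential tilt only shifts the mean and rescales. It will
  absorb the density ratio that reflection produces.\<close>

lemma normal_density_mult_exp:
  assumes "\<sigma> \<noteq> 0"
  shows "normal_density m \<sigma> x * exp (b * x) = exp (b * m + b\<^sup>2 * \<sigma>\<^sup>2 / 2) * normal_density (m + b * \<sigma>\<^sup>2) \<sigma> x"
proof -
  have "- (x - m)\<^sup>2 / (2 * \<sigma>\<^sup>2) + b * x = (b * m + b\<^sup>2 * \<sigma>\<^sup>2 / 2) + - (x - (m + b * \<sigma>\<^sup>2))\<^sup>2 / (2 * \<sigma>\<^sup>2)"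
    using assms by (simp add: field_simps power2_eq_square)
  then show ?thesis by (simp add: normal_density_def mult_exp_exp)
qed

subsection \<open>Queue length and net input\<close>

text \<open>In effect \<open>Q t\<close> is the maximum of \<open>v + z t\<close> and of all
  \<open>z t - z s\<close>. If the regulator is still \<open>0\<close> at time \<open>t\<close>,
  then \<open>Q t = v + z t\<close>; otherwise it is constant after the last empty time
  \<open>s\<close>, and \<open>Q t = z t - z s\<close>.\<close>

lemma queue_le_iff:
  assumes Q: "queue_length_path (time_domain \<Delta>) v z Q"
    and z: "continuous_on {0..t} z" and t: "0 < t" "ereal t < \<Delta>"
  shows "Q t \<le> q \<longleftrightarrow> v + z t \<le> q \<and> (\<forall>s\<in>{0..t}. z t - z s \<le> q)"
proof -
  obtain l where l: "regulator_path (time_domain \<Delta>) v z l" and Ql: "\<And>s. s \<in> time_domain \<Delta> \<Longrightarrow> Q s = v + z s + l s"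
    using Q unfolding queue_length_path_def by blast
  have sub: "{0..t} \<subseteq> time_domain \<Delta>"
    using t by (auto simp: time_domain_def intro: le_less_trans[of _ "ereal t"])
  have lc: "continuous_on {0..t} l" and l0: "l 0 = 0"
    and mono: "\<And>a b. 0 \<le> a \<Longrightarrow> a \<le> b \<Longrightarrow> b \<le> t \<Longrightarrow> l a \<le> l b"
    and nonneg: "\<And>s. s \<in> {0..t} \<Longrightarrow> 0 \<le> v + z s + l s"
    and zero: "\<And>a b. 0 \<le> a \<Longrightarrow> a \<le> b \<Longrightarrow> b \<le> t \<Longrightarrow> l a < l b \<Longrightarrow> \<exists>s\<in>{a..b}. v + z s + l s = 0"
    using l sub unfolding regulator_path_def
    by (auto intro: continuous_on_subset simp: mono_on_def subset_iff)
  have Qt: "Q t = v + z t + l t" by (rule Ql) (use sub t in auto)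
  show ?thesis
  proof
    assume q: "Q t \<le> q"
    have "z t - z s \<le> q" if s: "s \<in> {0..t}" for s
      using mono[of s t] nonneg[OF s] q s unfolding Qt by auto
    moreover have "0 \<le> l t" using mono[of 0 t] l0 t by auto
    ultimately show "v + z t \<le> q \<and> (\<forall>s\<in>{0..t}. z t - z s \<le> q)" using q unfolding Qt by auto
  next
    assume *: "v + z t \<le> q \<and> (\<forall>s\<in>{0..t}. z t - z s \<le> q)"
    show "Q t \<le> q"
    proof (cases "l t = 0")
      case True
      then show ?thesis using * by (simp add: Qt)
    next
      case False
      then have lt: "l 0 < l t" using mono[of 0 t] l0 t by auto
      \<comment> \<open>The empty times in \<open>{0..t}\<close> form a nonempty compact set, so
        there is a last one.\<close>
      define N where "N = {0..t} \<inter> (\<lambda>s. v + z s + l s) -` {0}"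
      have "closed N" unfolding N_def
        by (intro continuous_closed_preimage continuous_intros z lc)
      moreover have "N \<noteq> {}" using zero[of 0 t] lt t by (auto simp: N_def)
      moreover have "bounded N" by (rule bounded_subset[of "{0..t}"]) (auto simp: N_def)
      ultimately obtain s where s: "s \<in> N" "\<And>r. r \<in> N \<Longrightarrow> r \<le> s"
        using compact_attains_sup[of N] compact_eq_bounded_closed by blast
      have s_in: "0 \<le> s" "s \<le> t" and s0: "v + z s + l s = 0" using s(1) by (auto simp: N_def)
      have "l s = l t"
      proof (rule ccontr)
        \<comment> \<open>The regulator condition on \<open>{s..t}\<close> is already met by
          \<open>s\<close> itself. Continuity supplies some \<open>r > s\<close> with still
          \<open>l r < l t\<close>; the condition on \<open>{r..t}\<close> then yields an empty time
          after the last one.\<close>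
        assume "l s \<noteq> l t"
        then have less: "l s < l t" using mono[OF s_in] by auto
        then have "s < t" using s_in by (cases "s = t") auto
        have "\<forall>\<^sub>F r in at s within {0..t}. l r < l t"
          using lc s_in less by (intro order_tendstoD(2)[of l "l s"]) (auto simp: continuous_on_def)
        then obtain d where d: "0 < d" "\<And>r. r \<in> {0..t} \<Longrightarrow> r \<noteq> s \<Longrightarrow> dist r s < d \<Longrightarrow> l r < l t"
          unfolding eventually_at by blast
        define r where "r = min t (s + d / 2)"
        have r: "s < r" "r \<le> t" "dist r s < d" using d(1) \<open>s < t\<close> by (auto simp: r_def dist_real_def min_def)
        then have "l r < l t" using d(2)[of r] s_in by auto
        then obtain x where "x \<in> {r..t}" "v + z x + l x = 0" using zero[of r t] r s_in by auto
        then have "x \<in> N" using r s_in by (auto simp: N_def)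
        from s(2)[OF this] show False using \<open>x \<in> {r..t}\<close> r by auto
      qed
      then have "Q t = z t - z s" using s0 by (simp add: Qt)
      then show ?thesis using * s_in by auto
    qed
  qed
qed

subsection \<open>Gaussian processes and change of measure\<close>

text \<open>\<open>gaussian_process\<close> speaks of exactly these combinations. Closure under
  linear operations lets bridge increments and their weighted sums be recognised as Gaussian without
  exhibiting coefficients.\<close>

definition lin_span :: "('s \<Rightarrow> 'a \<Rightarrow> real) \<Rightarrow> 's set \<Rightarrow> ('a \<Rightarrow> real) set" where
  "lin_span X D = {Y. \<exists>J c. finite J \<and> J \<subseteq> D \<and> Y = (\<lambda>\<omega>. \<Sum>s\<in>J. c s * X s \<omega>)}"

lemma lin_span_base: "s \<in> D \<Longrightarrow> X s \<in> lin_span X D"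
  unfolding lin_span_def by (auto intro!: exI[of _ "{s}"] exI[of _ "\<lambda>_. 1"])

lemma lin_span_scale:
  assumes "Y \<in> lin_span X D"
  shows "(\<lambda>\<omega>. a * Y \<omega>) \<in> lin_span X D"
proof -
  obtain J c where "finite J" "J \<subseteq> D" "Y = (\<lambda>\<omega>. \<Sum>s\<in>J. c s * X s \<omega>)"
    using assms unfolding lin_span_def by auto
  then show ?thesis unfolding lin_span_def
    by (auto intro!: exI[of _ J] exI[of _ "\<lambda>s. a * c s"] simp: sum_distrib_left mult.assoc)
qed

lemma lin_span_add:
  assumes "Y \<in> lin_span X D" "Z \<in> lin_span X D"
  shows "(\<lambda>\<omega>. Y \<omega> + Z \<omega>) \<in> lin_span X D"
proof -
  obtain J c K d where J: "finite J" "J \<subseteq> D" "Y = (\<lambda>\<omega>. \<Sum>s\<in>J. c s * X s \<omega>)"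
    and K: "finite K" "K \<subseteq> D" "Z = (\<lambda>\<omega>. \<Sum>s\<in>K. d s * X s \<omega>)"
    using assms unfolding lin_span_def by auto
  \<comment> \<open>The two index sets are merged by giving missing times the coefficient
    \<open>0\<close>.\<close>
  have "(\<Sum>s\<in>J. c s * X s \<omega>) = (\<Sum>s\<in>J \<union> K. (if s \<in> J then c s else 0) * X s \<omega>)" for \<omega>
    using J K by (intro sum.mono_neutral_cong_left) auto
  moreover have "(\<Sum>s\<in>K. d s * X s \<omega>) = (\<Sum>s\<in>J \<union> K. (if s \<in> K then d s else 0) * X s \<omega>)" for \<omega>
    using J K by (intro sum.mono_neutral_cong_left) auto
  ultimately show ?thesis unfolding lin_span_def J K
    using J K by (intro CollectI exI[of _ "J \<union> K"]
        exI[of _ "\<lambda>s. (if s \<in> J then c s else 0) + (if s \<in> K then d s else 0)"])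
      (auto simp: sum.distrib distrib_right)
qed

lemma lin_span_diff:
  assumes "Y \<in> lin_span X D" "Z \<in> lin_span X D"
  shows "(\<lambda>\<omega>. Y \<omega> - Z \<omega>) \<in> lin_span X D"
  using lin_span_add[OF assms(1) lin_span_scale[OF assms(2), of "-1"]] by simp

lemma lin_span_sum:
  assumes "finite I" "\<And>i. i \<in> I \<Longrightarrow> Y i \<in> lin_span X D"
  shows "(\<lambda>\<omega>. \<Sum>i\<in>I. Y i \<omega>) \<in> lin_span X D"
  using assms
proof (induction I rule: finite_induct)
  case empty
  show ?case unfolding lin_span_def by (auto intro!: exI[of _ "{}"])
next
  case (insert i I)
  then show ?case using lin_span_add[of "Y i" X D "\<lambda>\<omega>. \<Sum>i\<in>I. Y i \<omega>"] by simp
qed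

lemma (in prob_space) gaussian_process_lin_span:
  assumes G: "gaussian_process M D X" and m: "\<And>s. s \<in> D \<Longrightarrow> expectation (X s) = 0"
    and Y: "Y \<in> lin_span X D"
  shows "gaussian_rv M Y" and "expectation Y = 0"
proof -
  obtain J c where J: "finite J" "J \<subseteq> D" and Y: "Y = (\<lambda>\<omega>. \<Sum>s\<in>J. c s * X s \<omega>)"
    using Y unfolding lin_span_def by auto
  show "gaussian_rv M Y" using G J unfolding gaussian_process_def Y by blast
  have "integrable M (X s)" if "s \<in> D" for s
  proof (rule gaussian_rv_integrable)
    show "gaussian_rv M (X s)"
      using G[unfolded gaussian_process_def, rule_format, of "{s}" "\<lambda>_. 1"] that by simp
  qed (rule m[OF that])
  then show "expectation Y = 0" unfolding Y using J m
    by (subst Bochner_Integration.integral_sum) (auto intro!: sum.neutral)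
qed

text \<open>Every \<open>a * Y + b * Z\<close> is a centred Gaussian whose variance has no cross
  term, so the joint characteristic function factors.\<close>

lemma (in prob_space) gaussian_process_uncorrelated_indep:
  assumes G: "gaussian_process M D X" and m: "\<And>s. s \<in> D \<Longrightarrow> expectation (X s) = 0"
    and Y: "Y \<in> lin_span X D" and Z: "Z \<in> lin_span X D"
    and unc: "expectation (\<lambda>\<omega>. Y \<omega> * Z \<omega>) = 0"
  shows "indep_var borel Y borel Z"
proof -
  note span = gaussian_process_lin_span[OF G m]
  have Ym[measurable]: "Y \<in> borel_measurable M" and Zm[measurable]: "Z \<in> borel_measurable M"
    using span(1)[OF _ Y] span(1)[OF _ Z] by (auto simp: gaussian_rv_def)
  have Y2: "integrable M (\<lambda>\<omega>. (Y \<omega>)\<^sup>2)" and Z2: "integrable M (\<lambda>\<omega>. (Z \<omega>)\<^sup>2)"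
    by (intro gaussian_rv_square_integrable span Y Z; assumption)+
  have YZ: "integrable M (\<lambda>\<omega>. Y \<omega> * Z \<omega>)" by (intro integrable_mult_of_squares Y2 Z2 Ym Zm)
  have var: "expectation (\<lambda>\<omega>. (a * Y \<omega> + b * Z \<omega>)\<^sup>2)
      = a\<^sup>2 * expectation (\<lambda>\<omega>. (Y \<omega>)\<^sup>2) + b\<^sup>2 * expectation (\<lambda>\<omega>. (Z \<omega>)\<^sup>2)" for a b
  proof -
    have "expectation (\<lambda>\<omega>. (a * Y \<omega> + b * Z \<omega>)\<^sup>2)
      = expectation (\<lambda>\<omega>. a\<^sup>2 * (Y \<omega>)\<^sup>2 + (b\<^sup>2 * (Z \<omega>)\<^sup>2 + (2 * a * b) * (Y \<omega> * Z \<omega>)))"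
      by (intro Bochner_Integration.integral_cong) (auto simp: power2_eq_square algebra_simps)
    also have "\<dots> = a\<^sup>2 * expectation (\<lambda>\<omega>. (Y \<omega>)\<^sup>2) + (b\<^sup>2 * expectation (\<lambda>\<omega>. (Z \<omega>)\<^sup>2)
        + (2 * a * b) * expectation (\<lambda>\<omega>. Y \<omega> * Z \<omega>))"
      using Y2 Z2 YZ
      by (simp only: Bochner_Integration.integral_add integrable_mult_right integral_mult_right_zero
           Bochner_Integration.integrable_add)
    finally show ?thesis by (simp add: unc)
  qed
  have chY: "char (distr M borel Y) a = exp (- (a\<^sup>2 * expectation (\<lambda>\<omega>. (Y \<omega>)\<^sup>2)) / 2)"
    and chZ: "char (distr M borel Z) a = exp (- (a\<^sup>2 * expectation (\<lambda>\<omega>. (Z \<omega>)\<^sup>2)) / 2)" for a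
    by (intro gaussian_rv_char span Y Z; assumption)+
  have joint: "expectation (\<lambda>\<omega>. iexp (a * Y \<omega> + b * Z \<omega>)) = char (distr M borel Y) a * char (distr M borel Z) b" for a b
  proof -
    let ?W = "\<lambda>\<omega>. a * Y \<omega> + b * Z \<omega>"
    have W: "?W \<in> lin_span X D" by (intro lin_span_add lin_span_scale Y Z)
    have "expectation (\<lambda>\<omega>. iexp (?W \<omega>)) = char (distr M borel ?W) 1"
      unfolding char_def by (subst integral_distr) auto
    also have "\<dots> = exp (- (1\<^sup>2 * expectation (\<lambda>\<omega>. (?W \<omega>)\<^sup>2)) / 2)"
      by (intro gaussian_rv_char span W; assumption)
    also have "\<dots> = char (distr M borel Y) a * char (distr M borel Z) b"
      unfolding var chY chZ by (simp add: mult_exp_exp add_divide_distrib flip: of_real_mult)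
    finally show ?thesis .
  qed
  have "indep_vars (\<lambda>_. borel) (case_bool Y Z) UNIV"
  proof (rule indep_vars_from_char)
    fix i show "case_bool Y Z i \<in> borel_measurable M" by (cases i) auto
  next
    fix u :: "bool \<Rightarrow> real"
    show "expectation (\<lambda>\<omega>. \<Prod>i\<in>UNIV. iexp (u i * case_bool Y Z i \<omega>))
        = (\<Prod>i\<in>UNIV. char (distr M borel (case_bool Y Z i)) (u i))"
      using joint[of "u True" "u False"] by (simp add: UNIV_bool exp_add distrib_left mult_ac)
  qed auto
  moreover have "case_bool borel borel = (\<lambda>_. borel :: real measure)" by (auto split: bool.split)
  ultimately show ?thesis unfolding indep_var_def by simp
qed

section \<open>Change of measure through one Gaussian variable\<close>

lemma (in prob_space) distr_reweight:
  assumes W: "distributed M lborel W (normal_density m s)" and "0 < s"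
    and [measurable]: "g \<in> borel_measurable borel" and g0: "\<And>x. 0 \<le> g x"
  shows "distr (density M (\<lambda>\<omega>. g (W \<omega>) / normal_density m s (W \<omega>))) lborel W = density lborel g"
proof -
  have [measurable]: "W \<in> borel_measurable M" using distributed_measurable[OF W] by simp
  have n: "0 < normal_density m s x" for x using \<open>0 < s\<close> by (rule normal_density_pos)
  have "distr (density M (\<lambda>\<omega>. g (W \<omega>) / normal_density m s (W \<omega>))) lborel W
      = density (distr M lborel W) (\<lambda>x. g x / normal_density m s x)"
    by (subst density_distr) auto
  also have "\<dots> = density lborel (\<lambda>x. ennreal (normal_density m s x) * ennreal (g x / normal_density m s x))"
    unfolding distributed_distr_eq_density[OF W] by (subst density_density_eq) auto
  also have "\<dots> = density lborel g"
    using n g0 by (intro density_cong) (auto simp: ennreal_mult'[symmetric] less_imp_neq[symmetric])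
  finally show ?thesis .
qed

lemma (in prob_space) prob_space_reweight:
  assumes W: "distributed M lborel W (normal_density m s)" and "0 < s" "0 < \<sigma>"
  shows "prob_space (density M (\<lambda>\<omega>. normal_density 0 \<sigma> (W \<omega>) / normal_density m s (W \<omega>)))" (is "prob_space ?N")
    and "distributed (density M (\<lambda>\<omega>. normal_density 0 \<sigma> (W \<omega>) / normal_density m s (W \<omega>))) lborel W (normal_density 0 \<sigma>)"
proof -
  have [measurable]: "W \<in> borel_measurable M" using distributed_measurable[OF W] by simp
  note D = distr_reweight[OF W \<open>0 < s\<close>, of "normal_density 0 \<sigma>", simplified]
  have "emeasure ?N (space ?N) = emeasure (distr ?N lborel W) (space lborel)"
    by (subst emeasure_distr) auto
  also have "\<dots> = 1"
    unfolding D using prob_space.emeasure_space_1[OF prob_space_normal_density[OF \<open>0 < \<sigma>\<close>, of 0]] by simp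
  finally show "prob_space ?N" by (rule prob_spaceI)
  show "distributed ?N lborel W (normal_density 0 \<sigma>)"
    unfolding distributed_def using D by auto
qed

text \<open>Knowing \<open>refl\<close> for every level up to \<open>c\<^sub>0\<close> fixes the law
  of \<open>W\<close> restricted to the event under \<open>N\<close>: its density is the centred
  normal density at \<open>2 * q - z\<close>, cut off at \<open>c\<^sub>0\<close>. Undoing the
  weight then leaves a multiple of a normal density with shifted mean.\<close>

lemma (in prob_space) crossing_prob_reweight:
  fixes m s \<sigma> q c\<^sub>0 :: real
  defines "b \<equiv> 2 * q / \<sigma>\<^sup>2"
  assumes W: "distributed M lborel W (normal_density m s)" and s: "0 < s" and \<sigma>: "0 < \<sigma>"
    and N_def: "N = density M (\<lambda>\<omega>. normal_density 0 \<sigma> (W \<omega>) / normal_density m s (W \<omega>))"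
    and C: "\<And>c. c \<le> c\<^sub>0 \<Longrightarrow> {\<omega> \<in> space M. P \<omega> \<and> W \<omega> \<le> c} \<in> events"
    and refl: "\<And>c. c \<le> c\<^sub>0 \<Longrightarrow> measure N {\<omega> \<in> space M. P \<omega> \<and> W \<omega> \<le> c} = measure N {\<omega> \<in> space M. 2 * q - c < W \<omega>}"
  shows "prob {\<omega> \<in> space M. P \<omega> \<and> W \<omega> \<le> c\<^sub>0}
       = exp (b * m + b\<^sup>2 * s\<^sup>2 / 2 - b * q) * ((1 + erf ((c\<^sub>0 - (m + b * s\<^sup>2)) / (s * sqrt 2))) / 2)"
proof -
  have Wm[measurable]: "W \<in> borel_measurable M" using distributed_measurable[OF W] by simp
  define A where "A = {\<omega> \<in> space M. P \<omega> \<and> W \<omega> \<le> c\<^sub>0}"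
  have Am[measurable]: "A \<in> events" unfolding A_def by (rule C) simp
  let ?f = "normal_density 0 \<sigma>" and ?g = "normal_density m s"
  have f: "0 < ?f x" and g: "0 < ?g x" for x using s \<sigma> by (auto intro: normal_density_pos)
  interpret N: prob_space N unfolding N_def by (rule prob_space_reweight(1)[OF W s \<sigma>])
  have [measurable]: "W \<in> borel_measurable N" "A \<in> sets N" by (simp_all add: N_def)
  have spN: "space N = space M" by (simp add: N_def)
  have DN: "distributed N lborel W ?f" unfolding N_def by (rule prob_space_reweight(2)[OF W s \<sigma>])
  let ?h = "\<lambda>z. ?f (2 * q - z) * indicator {..c\<^sub>0} z"
  \<comment> \<open>\<open>\<mu>\<close> is the law of \<open>W\<close> restricted to
    \<open>A\<close> under \<open>N\<close>, and \<open>\<nu>\<close> is its claimed form; they are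
    compared through their distribution functions.\<close>
  define \<mu> where "\<mu> = distr (density N (indicator A)) borel W"
  define \<nu> where "\<nu> = density lborel (\<lambda>z. ennreal (?h z))"
  have dens_ind: "emeasure (density N (indicator A)) B = emeasure N (A \<inter> B)" if [measurable]: "B \<in> sets N" for B
    by (subst emeasure_density) (auto simp flip: indicator_inter_arith)
  have em: "emeasure \<mu> {..c} = emeasure \<nu> {..c}" for c
  proof -
    have "emeasure \<mu> {..c} = emeasure (density N (indicator A)) (W -` {..c} \<inter> space N)"
      unfolding \<mu>_def by (subst emeasure_distr) auto
    also have "\<dots> = emeasure N (A \<inter> (W -` {..c} \<inter> space N))"
      by (rule dens_ind) auto
    also have "A \<inter> (W -` {..c} \<inter> space N) = {\<omega> \<in> space M. P \<omega> \<and> W \<omega> \<le> min c c\<^sub>0}"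
      by (auto simp: A_def spN)
    also have "emeasure N \<dots> = emeasure N {\<omega> \<in> space M. 2 * q - min c c\<^sub>0 < W \<omega>}"
      using refl[of "min c c\<^sub>0"] by (simp add: N.emeasure_eq_measure)
    also have "{\<omega> \<in> space M. 2 * q - min c c\<^sub>0 < W \<omega>} = W -` {2 * q - min c c\<^sub>0<..} \<inter> space N"
      by (auto simp: spN)
    also have "emeasure N \<dots> = (\<integral>\<^sup>+y. ?f y * indicator {2 * q - min c c\<^sub>0<..} y \<partial>lborel)"
      by (subst distributed_emeasure[OF DN]) (auto intro!: nn_integral_cong simp: indicator_def)
    also have "\<dots> = (\<integral>\<^sup>+y. ?f (2 * q + (- 1) * y) * indicator {2 * q - min c c\<^sub>0<..} (2 * q + (- 1) * y) \<partial>lborel)"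
      by (subst nn_integral_real_affine[where c="-1" and t="2 * q"]) auto
    \<comment> \<open>The reflection \<open>y \<mapsto> 2 * q - y\<close> yields the strict bound
      \<open>y < min c c\<^sub>0\<close>; the endpoint is a null set.\<close>
    also have "\<dots> = (\<integral>\<^sup>+y. ennreal (?h y) * indicator {..c} y \<partial>lborel)"
      using AE_lborel_singleton[of "min c c\<^sub>0"]
      by (intro nn_integral_cong_AE) (auto elim!: eventually_mono simp: indicator_def min_def split: if_splits)
    also have "\<dots> = emeasure \<nu> {..c}"
      unfolding \<nu>_def by (subst emeasure_density) auto
    finally show ?thesis .
  qed
  have fin\<mu>: "finite_measure \<mu>"
    unfolding \<mu>_def
    by (intro finite_measure.finite_measure_distr finite_measureI)
       (auto simp: dens_ind N.emeasure_eq_measure)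
  \<comment> \<open>\<open>\<nu>\<close> lives on \<open>{..c\<^sub>0}\<close>, so its total mass is
    a value of its distribution function, which agrees with that of the finite measure
    \<open>\<mu>\<close>.\<close>
  have "finite_measure \<nu>"
  proof (rule finite_measureI)
    have "emeasure \<nu> (space \<nu>) = emeasure \<nu> {..c\<^sub>0}"
      unfolding \<nu>_def by (subst (1 2) emeasure_density) (auto intro!: nn_integral_cong simp: indicator_def)
    then show "emeasure \<nu> (space \<nu>) \<noteq> \<infinity>"
      unfolding em[symmetric] using finite_measure.emeasure_finite[OF fin\<mu>] by simp
  qed
  then have \<mu>\<nu>: "\<mu> = \<nu>"
    using fin\<mu> em
    by (intro cdf_unique') (auto simp: finite_borel_measure_def finite_borel_measure_axioms_def
        \<mu>_def \<nu>_def cdf_def measure_def fun_eq_iff)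
  have "emeasure M A = (\<integral>\<^sup>+\<omega>. indicator A \<omega> \<partial>M)" by simp
  \<comment> \<open>Both densities are positive, so inserting
    \<open>(?f / ?g) * (?g / ?f) = 1\<close> passes from \<open>M\<close> to
    \<open>N\<close>.\<close>
  also have "\<dots> = (\<integral>\<^sup>+\<omega>. ennreal (?f (W \<omega>) / ?g (W \<omega>)) * (indicator A \<omega> * ennreal (?g (W \<omega>) / ?f (W \<omega>))) \<partial>M)"
  proof (intro nn_integral_cong)
    fix \<omega>
    have "ennreal (?f (W \<omega>) / ?g (W \<omega>)) * ennreal (?g (W \<omega>) / ?f (W \<omega>)) = 1"
      using f[of "W \<omega>"] g[of "W \<omega>"] by (simp flip: ennreal_mult')
    then show "indicator A \<omega> = ennreal (?f (W \<omega>) / ?g (W \<omega>)) * (indicator A \<omega> * ennreal (?g (W \<omega>) / ?f (W \<omega>)))"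
      by (simp add: mult.left_commute)
  qed
  also have "\<dots> = (\<integral>\<^sup>+\<omega>. indicator A \<omega> * ennreal (?g (W \<omega>) / ?f (W \<omega>)) \<partial>N)"
    unfolding N_def by (subst nn_integral_density) auto
  also have "\<dots> = (\<integral>\<^sup>+z. ennreal (?g z / ?f z) \<partial>\<mu>)"
    unfolding \<mu>_def by (subst nn_integral_distr) (auto simp: nn_integral_density)
  also have "\<dots> = (\<integral>\<^sup>+z. ennreal (?h z) * ennreal (?g z / ?f z) \<partial>lborel)"
    unfolding \<mu>\<nu> \<nu>_def by (subst nn_integral_density) auto
  also have "\<dots> = (\<integral>\<^sup>+z. ennreal (exp (b * m + b\<^sup>2 * s\<^sup>2 / 2 - b * q) * (indicator {..c\<^sub>0} z * normal_density (m + b * s\<^sup>2) s z)) \<partial>lborel)"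
  proof (intro nn_integral_cong)
    fix z
    \<comment> \<open>Origin of \<open>b\<close>: the difference of the two squares is
      \<open>4 * q * z - 4 * q\<^sup>2\<close>, divided by
      \<open>2 * \<sigma>\<^sup>2\<close>.\<close>
    have "- (2 * q - z)\<^sup>2 / (2 * \<sigma>\<^sup>2) = - z\<^sup>2 / (2 * \<sigma>\<^sup>2) + (b * z - b * q)"
      unfolding b_def using \<sigma> by (simp add: field_simps power2_eq_square)
    then have "?f (2 * q - z) = ?f z * exp (b * z - b * q)"
      unfolding normal_density_def by (simp only: diff_0_right exp_add mult.assoc)
    then have "?f (2 * q - z) * (?g z / ?f z) = (?g z * exp (b * z)) * exp (- (b * q))"
      using f[of z] by (simp add: exp_diff exp_minus field_simps)
    also have "\<dots> = exp (b * m + b\<^sup>2 * s\<^sup>2 / 2 - b * q) * normal_density (m + b * s\<^sup>2) s z"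
    proof -
      have "exp (b * m + b\<^sup>2 * s\<^sup>2 / 2 - b * q) = exp (b * m + b\<^sup>2 * s\<^sup>2 / 2) * exp (- (b * q))"
        by (simp only: diff_conv_add_uminus exp_add)
      then show ?thesis using s normal_density_mult_exp[of s m z b] by simp
    qed
    finally show "ennreal (?h z) * ennreal (?g z / ?f z)
      = ennreal (exp (b * m + b\<^sup>2 * s\<^sup>2 / 2 - b * q) * (indicator {..c\<^sub>0} z * normal_density (m + b * s\<^sup>2) s z))"
      using f[of z] g[of z] f[of "2 * q - z"] by (auto simp: indicator_def ennreal_mult'[symmetric])
  qed
  also have "\<dots> = ennreal (exp (b * m + b\<^sup>2 * s\<^sup>2 / 2 - b * q)) * (\<integral>\<^sup>+z. ennreal (indicator {..c\<^sub>0} z * normal_density (m + b * s\<^sup>2) s z) \<partial>lborel)"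
    by (simp only: ennreal_mult'[OF exp_ge_zero]) (rule nn_integral_cmult, measurable)
  also have "\<dots> = ennreal (exp (b * m + b\<^sup>2 * s\<^sup>2 / 2 - b * q) * ((1 + erf ((c\<^sub>0 - (m + b * s\<^sup>2)) / (s * sqrt 2))) / 2))"
    by (simp only: nn_integral_normal_density_atMost(1)[OF s] ennreal_mult'[OF exp_ge_zero])
  finally have "ennreal (prob A) = ennreal (exp (b * m + b\<^sup>2 * s\<^sup>2 / 2 - b * q) * ((1 + erf ((c\<^sub>0 - (m + b * s\<^sup>2)) / (s * sqrt 2))) / 2))"
    by (simp add: emeasure_eq_measure)
  then show ?thesis
    unfolding A_def[symmetric] using erf_normal_nonneg[OF s] by (subst (asm) ennreal_inj) auto
qed

subsection \<open>GMSI processes\<close>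

lemma gmsi_process_covariance:
  assumes "gmsi_process M \<theta> \<tau> \<Delta> X" and "s \<in> time_domain \<Delta>" "u \<in> time_domain \<Delta>"
  shows "(LINT \<omega>|M. X s \<omega> * X u \<omega>) = \<theta> * min s u - \<tau> * s * u"
proof -
  have cov: "(LINT \<omega>|M. X s \<omega> * X u \<omega>) = s * (\<theta> - \<tau> * u)"
    if "s \<in> time_domain \<Delta>" "u \<in> time_domain \<Delta>" "s \<le> u" for s u
    using assms(1) that unfolding gmsi_process_def by blast
  show ?thesis
  proof (cases "s \<le> u")
    case True
    then show ?thesis using cov[of s u] assms by (simp add: algebra_simps)
  next
    case False
    then show ?thesis using cov[of u s] assms by (simp add: algebra_simps min_def)
  qed
qed

text \<open>The right side belongs to \<open>n\<close> independent
  \<open>N(0, \<theta> * t / n)\<close> increments. Each increment of \<open>B\<close> is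
  \<open>Z t / n\<close> plus a bridge increment, and the weight affects only the first summand. The
  variance of the bridge part falls short by \<open>\<theta> * t * A\<^sup>2\<close>, exactly what
  \<open>A * Z t\<close> contributes once \<open>Z t\<close> has variance
  \<open>\<theta> * t\<close>.\<close>

lemma gmsi_process_reweighted_increments:
  fixes X :: "real \<Rightarrow> 'a \<Rightarrow> real" and \<rho> \<theta> \<tau> t :: real and n :: nat and u :: "nat \<Rightarrow> real"
  defines "Z \<equiv> \<lambda>s \<omega>. \<rho> * s + X s \<omega>"
  defines "B \<equiv> \<lambda>s \<omega>. Z t \<omega> - Z (t - s) \<omega>"
  assumes gmsi: "gmsi_process M \<theta> \<tau> \<Delta> X" and t: "0 < t" "ereal t < \<Delta>"
    and W: "distributed M lborel (Z t) (normal_density m s)" and s: "0 < s"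
    and N_def: "N = density M (\<lambda>\<omega>. normal_density 0 (sqrt (\<theta> * t)) (Z t \<omega>) / normal_density m s (Z t \<omega>))"
    and n: "0 < n"
  shows "(LINT \<omega>|N. (\<Prod>i<n. iexp (u i * (B (t * Suc i / n) \<omega> - B (t * i / n) \<omega>))))
       = (\<Prod>i<n. exp (- ((u i)\<^sup>2 * (\<theta> * t / n)) / 2))"
proof -
  interpret prob_space M using gmsi by (simp add: gmsi_process_def)
  let ?D = "time_domain \<Delta>"
  have \<theta>: "0 < \<theta>" and G: "gaussian_process M ?D X" and mean: "\<And>s. s \<in> ?D \<Longrightarrow> expectation (X s) = 0"
    using gmsi by (auto simp: gmsi_process_def)
  have \<sigma>: "0 < sqrt (\<theta> * t)" using \<theta> t by simp
  have D: "r \<in> ?D" if "0 \<le> r" "r \<le> t" for r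
    using that t by (auto simp: time_domain_def intro: le_less_trans[of _ "ereal t"])
  note span = gaussian_process_lin_span[OF G mean]
  have sq: "integrable M (\<lambda>\<omega>. (Y \<omega>)\<^sup>2)" and Ym: "Y \<in> borel_measurable M" if "Y \<in> lin_span X ?D" for Y
    using span[OF _ that] gaussian_rv_square_integrable[of Y] by (auto simp: gaussian_rv_def)
  have int: "integrable M (\<lambda>\<omega>. Y \<omega> * Y' \<omega>)" if "Y \<in> lin_span X ?D" "Y' \<in> lin_span X ?D" for Y Y'
    using that by (intro integrable_mult_of_squares sq Ym)
  have cov: "expectation (\<lambda>\<omega>. X r \<omega> * X r' \<omega>) = \<theta> * min r r' - \<tau> * r * r'" if "r \<in> ?D" "r' \<in> ?D" for r r'
    by (rule gmsi_process_covariance[OF gmsi that])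
  \<comment> \<open>Reversed grid, running down from \<open>p 0 = t\<close> to
    \<open>p n = 0\<close>: an increment of \<open>B\<close> is \<open>Z\<close> at
    \<open>p i\<close> minus \<open>Z\<close> at \<open>p (Suc i)\<close>.\<close>
  define p where "p = (\<lambda>i::nat. t - t * real i / real n)"
  have p: "p i \<in> ?D" "0 \<le> p i" "p i \<le> t" if "i \<le> n" for i
  proof -
    have "t * real i / real n \<le> t" using that t n by (simp add: field_simps)
    then show "0 \<le> p i" "p i \<le> t" using t by (auto simp: p_def)
    then show "p i \<in> ?D" by (rule D)
  qed
  have pS: "p i - p (Suc i) = t / n" for i by (simp add: p_def distrib_left add_divide_distrib)
  have pmono: "p j \<le> p i" if "i \<le> j" for i j
    using that t n by (auto simp: p_def field_simps mult_mono)
  have tD: "t \<in> ?D" using t by (intro D) auto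
  \<comment> \<open>Increment of the bridge \<open>X r - (r / t) * X t\<close> over a time step
    \<open>t / n\<close>, hence the factor \<open>1 / n\<close>.\<close>
  define E where "E = (\<lambda>i \<omega>. X (p i) \<omega> - X (p (Suc i)) \<omega> - (1 / n) * X t \<omega>)"
  have Esp: "E i \<in> lin_span X ?D" if "i < n" for i
    unfolding E_def using that p[of i] p[of "Suc i"] tD
    by (intro lin_span_diff lin_span_scale lin_span_base) auto
  have Xsp: "X r \<in> lin_span X ?D" if "r \<in> ?D" for r using that by (rule lin_span_base)
  have covXE: "expectation (\<lambda>\<omega>. X r \<omega> * E j \<omega>) = \<theta> * (min r (p j) - min r (p (Suc j))) - \<theta> * r / n"
    if r: "r \<in> ?D" "r \<le> t" and j: "j < n" for r j
  proof -
    have pj: "p j \<in> ?D" "p (Suc j) \<in> ?D" using p j by auto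
    have "expectation (\<lambda>\<omega>. X r \<omega> * E j \<omega>)
      = expectation (\<lambda>\<omega>. X r \<omega> * X (p j) \<omega> - X r \<omega> * X (p (Suc j)) \<omega> - (1 / n) * (X r \<omega> * X t \<omega>))"
      by (intro Bochner_Integration.integral_cong) (auto simp: E_def algebra_simps)
    also have "\<dots> = expectation (\<lambda>\<omega>. X r \<omega> * X (p j) \<omega>) - expectation (\<lambda>\<omega>. X r \<omega> * X (p (Suc j)) \<omega>)
        - (1 / n) * expectation (\<lambda>\<omega>. X r \<omega> * X t \<omega>)"
      using int[OF Xsp Xsp, OF r(1) pj(1)] int[OF Xsp Xsp, OF r(1) pj(2)] int[OF Xsp Xsp, OF r(1) tD]
      by (simp only: Bochner_Integration.integral_diff integrable_mult_right integral_mult_right_zero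
          Bochner_Integration.integrable_diff)
    also have "\<dots> = \<theta> * (min r (p j) - min r (p (Suc j))) - \<tau> * r * (p j - p (Suc j)) - (\<theta> * r - \<tau> * r * t) / n"
    proof -
      have "min r t = r" using r by simp
      then show ?thesis by (simp add: cov r pj tD algebra_simps diff_divide_distrib)
    qed
    also have "\<dots> = \<theta> * (min r (p j) - min r (p (Suc j))) - \<theta> * r / n"
    proof -
      \<comment> \<open>Here \<open>\<tau>\<close> disappears: subtracting the share of
        \<open>X t\<close> compensates the quadratic term of the covariance.\<close>
      have "\<tau> * r * (t / n) + (\<theta> * r - \<tau> * r * t) / n = \<theta> * r / n"
        unfolding times_divide_eq_right add_divide_distrib[symmetric] by simp
      then show ?thesis unfolding pS by linarith
    qed
    finally show ?thesis .
  qed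
  have covtE: "expectation (\<lambda>\<omega>. X t \<omega> * E j \<omega>) = 0" if "j < n" for j
  proof -
    have "p j \<le> t" "p (Suc j) \<le> t" using p[of j] p[of "Suc j"] that by auto
    then have "min t (p j) - min t (p (Suc j)) = t / n" using pS[of j] by (simp add: min_absorb2)
    then show ?thesis using covXE[OF tD _ that] by simp
  qed
  have covEE: "expectation (\<lambda>\<omega>. E i \<omega> * E j \<omega>) = (if i = j then \<theta> * t / n else 0) - \<theta> * t / (real n)\<^sup>2"
    if i: "i < n" and j: "j < n" for i j
  proof -
    have pi: "p i \<in> ?D" "p (Suc i) \<in> ?D" "p i \<le> t" "p (Suc i) \<le> t" using p[of i] p[of "Suc i"] i by auto
    have "expectation (\<lambda>\<omega>. E i \<omega> * E j \<omega>)
      = expectation (\<lambda>\<omega>. X (p i) \<omega> * E j \<omega> - X (p (Suc i)) \<omega> * E j \<omega> - (1 / n) * (X t \<omega> * E j \<omega>))"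
      by (intro Bochner_Integration.integral_cong) (auto simp: fun_cong[OF E_def, of i] left_diff_distrib mult.assoc)
    also have "\<dots> = expectation (\<lambda>\<omega>. X (p i) \<omega> * E j \<omega>) - expectation (\<lambda>\<omega>. X (p (Suc i)) \<omega> * E j \<omega>)
        - (1 / n) * expectation (\<lambda>\<omega>. X t \<omega> * E j \<omega>)"
      using int[OF Xsp Esp, OF pi(1) j] int[OF Xsp Esp, OF pi(2) j] int[OF Xsp Esp, OF tD j]
      by (simp only: Bochner_Integration.integral_diff integrable_mult_right integral_mult_right_zero
          Bochner_Integration.integrable_diff)
    also have "\<dots> = \<theta> * ((min (p i) (p j) - min (p i) (p (Suc j))) - (min (p (Suc i)) (p j) - min (p (Suc i)) (p (Suc j))))
        - \<theta> * (p i - p (Suc i)) / n"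
      unfolding covXE[OF pi(1,3) j] covXE[OF pi(2,4) j] covtE[OF j]
      by (simp add: algebra_simps diff_divide_distrib)
    \<comment> \<open>This double difference of \<open>min\<close> is the length of the overlap of
      the time steps \<open>i\<close> and \<open>j\<close>, which share at most an endpoint unless
      \<open>i = j\<close>.\<close>
    also have "(min (p i) (p j) - min (p i) (p (Suc j))) - (min (p (Suc i)) (p j) - min (p (Suc i)) (p (Suc j)))
        = (if i = j then t / n else 0)"
    proof -
      consider "i = j" | "Suc i \<le> j" | "Suc j \<le> i" by linarith
      then show ?thesis
      proof cases
        case 1
        then show ?thesis using pS[of j] pmono[of j "Suc j"] by (simp add: min_absorb1 min_absorb2)
      next
        case 2
        then show ?thesis using pmono[of i "Suc i"] pmono[OF 2] pmono[of j "Suc j"]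
          by (simp add: min_absorb1 min_absorb2)
      next
        case 3
        then show ?thesis using pmono[of i "Suc i"] pmono[OF 3] pmono[of j "Suc j"]
          by (simp add: min_absorb1 min_absorb2)
      qed
    qed
    finally show ?thesis unfolding pS by (simp add: power2_eq_square)
  qed
  \<comment> \<open>The combination of the increments of \<open>B\<close> with coefficients
    \<open>u i\<close> will be \<open>A * Z t + V\<close>; drift and endpoint sit in the first term,
    the bridge in \<open>V\<close>.\<close>
  define V where "V = (\<lambda>\<omega>. \<Sum>i<n. u i * E i \<omega>)"
  define A where "A = (\<Sum>i<n. u i) / n"
  have Vsp: "V \<in> lin_span X ?D"
    unfolding V_def by (intro lin_span_sum lin_span_scale Esp) auto
  have [measurable]: "X t \<in> borel_measurable M" "V \<in> borel_measurable M"
    using Ym[OF Xsp[OF tD]] Ym[OF Vsp] by auto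
  have varV: "expectation (\<lambda>\<omega>. (V \<omega>)\<^sup>2) = (\<Sum>i<n. (u i)\<^sup>2 * (\<theta> * t / n)) - \<theta> * t * A\<^sup>2"
  proof -
    have "expectation (\<lambda>\<omega>. (V \<omega>)\<^sup>2) = expectation (\<lambda>\<omega>. \<Sum>i<n. \<Sum>j<n. u i * u j * (E i \<omega> * E j \<omega>))"
      by (intro Bochner_Integration.integral_cong) (auto simp: V_def power2_eq_square sum_product mult_ac)
    also have "\<dots> = (\<Sum>i<n. \<Sum>j<n. u i * u j * expectation (\<lambda>\<omega>. E i \<omega> * E j \<omega>))"
    proof -
      have i: "integrable M (\<lambda>\<omega>. u i * u j * (E i \<omega> * E j \<omega>))" if "i < n" "j < n" for i j
        by (intro integrable_mult_right int Esp that)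
      have "expectation (\<lambda>\<omega>. \<Sum>i<n. \<Sum>j<n. u i * u j * (E i \<omega> * E j \<omega>))
          = (\<Sum>i<n. expectation (\<lambda>\<omega>. \<Sum>j<n. u i * u j * (E i \<omega> * E j \<omega>)))"
        by (intro Bochner_Integration.integral_sum Bochner_Integration.integrable_sum i) auto
      also have "\<dots> = (\<Sum>i<n. \<Sum>j<n. expectation (\<lambda>\<omega>. u i * u j * (E i \<omega> * E j \<omega>)))"
        by (intro sum.cong Bochner_Integration.integral_sum i) auto
      finally show ?thesis by simp
    qed
    also have "\<dots> = (\<Sum>i<n. \<Sum>j<n. (if i = j then (u i)\<^sup>2 * (\<theta> * t / n) else 0) - u i * u j * (\<theta> * t / (real n)\<^sup>2))"
      by (intro sum.cong) (auto simp: covEE power2_eq_square algebra_simps)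
    also have "\<dots> = (\<Sum>i<n. (u i)\<^sup>2 * (\<theta> * t / n)) - (\<Sum>i<n. u i) * (\<Sum>i<n. u i) * (\<theta> * t / (real n)\<^sup>2)"
    proof -
      have "(\<Sum>i<n. \<Sum>j<n. u i * u j * c) = (\<Sum>i<n. u i) * (\<Sum>i<n. u i) * c" for c
        unfolding sum_product by (simp only: sum_distrib_right)
      from this[of "\<theta> * t / (real n)\<^sup>2"] show ?thesis by (simp add: sum_subtractf)
    qed
    also have "(\<Sum>i<n. u i) * (\<Sum>i<n. u i) * (\<theta> * t / (real n)\<^sup>2) = \<theta> * t * A\<^sup>2"
      by (simp add: A_def power2_eq_square)
    finally show ?thesis .
  qed
  have covV: "expectation (\<lambda>\<omega>. X t \<omega> * V \<omega>) = 0"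
  proof -
    have "expectation (\<lambda>\<omega>. X t \<omega> * V \<omega>) = expectation (\<lambda>\<omega>. \<Sum>i<n. u i * (X t \<omega> * E i \<omega>))"
      by (intro Bochner_Integration.integral_cong) (auto simp: V_def sum_distrib_left mult_ac)
    also have "\<dots> = (\<Sum>i<n. u i * expectation (\<lambda>\<omega>. X t \<omega> * E i \<omega>))"
      by (subst Bochner_Integration.integral_sum)
         (auto intro!: integrable_mult_right int Esp Xsp tD)
    finally show ?thesis by (simp add: covtE)
  qed
  have indep: "indep_var borel (X t) borel V"
    by (rule gaussian_process_uncorrelated_indep[OF G mean Xsp[OF tD] Vsp covV])
  have [measurable]: "Z t \<in> borel_measurable M" unfolding Z_def by measurable
  interpret N: prob_space N unfolding N_def by (rule prob_space_reweight(1)[OF W s \<sigma>])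
  have DN: "distributed N lborel (Z t) (normal_density 0 (sqrt (\<theta> * t)))"
    unfolding N_def by (rule prob_space_reweight(2)[OF W s \<sigma>])
  \<comment> \<open>The weight is expressed through \<open>X t\<close>, the variable shown to be
    independent of \<open>V\<close>.\<close>
  let ?r = "\<lambda>x. normal_density 0 (sqrt (\<theta> * t)) (\<rho> * t + x) / normal_density m s (\<rho> * t + x)"
  let ?f = "\<lambda>x. ?r x *\<^sub>R iexp (A * (\<rho> * t + x))" and ?g = "\<lambda>x::real. iexp x"
  have N': "N = density M (\<lambda>\<omega>. ?r (X t \<omega>))" unfolding N_def Z_def ..
  have "integrable N (\<lambda>\<omega>. iexp (A * Z t \<omega>))"
    by (rule N.integrable_const_bound[where B=1]) (auto simp: N_def)
  then have intf: "integrable M (\<lambda>\<omega>. ?f (X t \<omega>))"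
    unfolding N' by (subst (asm) integrable_density) (auto simp: Z_def)
  have intg: "integrable M (\<lambda>\<omega>. ?g (V \<omega>))"
    by (rule integrable_const_bound[where B=1]) auto
  have fg: "indep_var borel (\<lambda>\<omega>. ?f (X t \<omega>)) borel (\<lambda>\<omega>. ?g (V \<omega>))"
    using indep_var_compose[OF indep, of ?f borel ?g borel] by (simp add: comp_def)
  have incr: "B (t * Suc i / n) \<omega> - B (t * i / n) \<omega> = Z t \<omega> / n + E i \<omega>" for i \<omega>
  proof -
    have "B (t * Suc i / n) \<omega> - B (t * i / n) \<omega> = \<rho> * (p i - p (Suc i)) + X (p i) \<omega> - X (p (Suc i)) \<omega>"
      by (simp add: B_def Z_def p_def algebra_simps)
    then show ?thesis unfolding pS by (simp add: E_def Z_def add_divide_distrib)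
  qed
  have "(\<Prod>i<n. iexp (u i * (B (t * Suc i / n) \<omega> - B (t * i / n) \<omega>))) = iexp (A * Z t \<omega>) * ?g (V \<omega>)" for \<omega>
  proof -
    have "(\<Sum>i<n. u i * (B (t * Suc i / n) \<omega> - B (t * i / n) \<omega>)) = A * Z t \<omega> + V \<omega>"
      unfolding incr by (simp add: A_def V_def distrib_left sum.distrib sum_distrib_right sum_divide_distrib)
    then have "iexp (\<Sum>i<n. u i * (B (t * Suc i / n) \<omega> - B (t * i / n) \<omega>)) = iexp (A * Z t \<omega>) * ?g (V \<omega>)"
      by (simp add: exp_add distrib_left)
    then show ?thesis by (simp add: exp_sum sum_distrib_left)
  qed
  then have "(LINT \<omega>|N. (\<Prod>i<n. iexp (u i * (B (t * Suc i / n) \<omega> - B (t * i / n) \<omega>))))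
      = (LINT \<omega>|N. iexp (A * Z t \<omega>) * ?g (V \<omega>))" by (simp only:)
  also have "\<dots> = expectation (\<lambda>\<omega>. ?f (X t \<omega>) * ?g (V \<omega>))"
    unfolding N' by (subst integral_density) (auto simp: Z_def mult_ac)
  also have "\<dots> = expectation (\<lambda>\<omega>. ?f (X t \<omega>)) * expectation (\<lambda>\<omega>. ?g (V \<omega>))"
    by (rule indep_var_lebesgue_integral[OF fg intf intg])
  also have "expectation (\<lambda>\<omega>. ?f (X t \<omega>)) = (LINT \<omega>|N. iexp (A * Z t \<omega>))"
    unfolding N' by (subst integral_density) (auto simp: Z_def)
  also have "\<dots> = char (distr N borel (Z t)) A"
    unfolding char_def by (subst integral_distr) (auto simp: N_def)
  also have "\<dots> = exp (- (A\<^sup>2 * (\<theta> * t)) / 2)"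
    using N.char_centered_normal[OF DN \<sigma>, of A] \<theta> t by simp
  also have "expectation (\<lambda>\<omega>. ?g (V \<omega>)) = char (distr M borel V) 1"
    unfolding char_def by (subst integral_distr) auto
  also have "\<dots> = exp (- (1\<^sup>2 * expectation (\<lambda>\<omega>. (V \<omega>)\<^sup>2)) / 2)"
    by (intro gaussian_rv_char span Vsp; assumption)
  also have "complex_of_real (exp (- (A\<^sup>2 * (\<theta> * t)) / 2)) * \<dots>
      = complex_of_real (exp (\<Sum>i<n. - ((u i)\<^sup>2 * (\<theta> * t / n)) / 2))"
  proof -
    have "- (A\<^sup>2 * (\<theta> * t)) / 2 + - (1\<^sup>2 * expectation (\<lambda>\<omega>. (V \<omega>)\<^sup>2)) / 2 = (\<Sum>i<n. - ((u i)\<^sup>2 * (\<theta> * t / n)) / 2)"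
      unfolding varV by (simp add: sum_divide_distrib[symmetric] sum_negf field_simps)
    then show ?thesis by (simp only: mult_exp_exp flip: of_real_mult)
  qed
  finally show ?thesis by (simp add: exp_sum)
qed

text \<open>\<open>\<tau> * t < \<theta>\<close> makes the variance positive, which rules out a
  point mass.\<close>

lemma gmsi_process_endpoint:
  assumes gmsi: "gmsi_process M \<theta> \<tau> \<Delta> X" and t: "0 < t" "ereal t < \<Delta>" and \<tau>: "\<tau> * t < \<theta>"
  shows "distributed M lborel (\<lambda>\<omega>. \<rho> * t + X t \<omega>) (normal_density (\<rho> * t) (sqrt (t * (\<theta> - \<tau> * t))))"
proof -
  interpret prob_space M using gmsi by (simp add: gmsi_process_def)
  have tD: "t \<in> time_domain \<Delta>" using t by (simp add: time_domain_def)
  have s: "0 < sqrt (t * (\<theta> - \<tau> * t))" using t \<tau> by simp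
  have G: "gaussian_process M (time_domain \<Delta>) X" and mean: "\<And>s. s \<in> time_domain \<Delta> \<Longrightarrow> expectation (X s) = 0"
    using gmsi by (auto simp: gmsi_process_def)
  have "distributed M lborel (X t) (normal_density 0 (sqrt (t * (\<theta> - \<tau> * t))))"
  proof (rule gaussian_rv_distributed)
    show "gaussian_rv M (X t)" by (rule gaussian_process_lin_span(1)[OF G mean lin_span_base[OF tD]])
    show "expectation (\<lambda>\<omega>. (X t \<omega>)\<^sup>2) = (sqrt (t * (\<theta> - \<tau> * t)))\<^sup>2"
      using gmsi_process_covariance[OF gmsi tD tD] t \<tau> by (simp add: power2_eq_square algebra_simps)
  qed (use mean tD s in auto)
  from normal_density_affine[OF this s, of 1 "\<rho> * t"] show ?thesis by simp
qed

text \<open>The event is \<open>Z t \<le> q - v\<close> without a crossing of \<open>q\<close> by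
  the reversed path, so a crossing probability is subtracted from a normal distribution function.
  \<open>0 \<le> v\<close> gives \<open>q - v \<le> q\<close>, the range where reflection
  applies.\<close>

lemma gmsi_queue_distribution:
  fixes \<theta> \<rho> v t q \<tau> :: real
  defines "b \<equiv> 2 * q / (\<theta> * t)" and "s \<equiv> sqrt (t * (\<theta> - \<tau> * t))"
  assumes gmsi: "gmsi_process M \<theta> \<tau> \<Delta> X" and t: "0 < t" "ereal t < \<Delta>" and \<tau>: "\<tau> * t < \<theta>"
    and v: "0 \<le> v" and q: "0 \<le> q"
    and Q: "\<And>\<omega>. \<omega> \<in> space M \<Longrightarrow>
        queue_length_path (time_domain \<Delta>) v (\<lambda>s. \<rho> * s + X s \<omega>) (\<lambda>s. Q s \<omega>)"
  shows "measure M {\<omega> \<in> space M. Q t \<omega> \<le> q}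
       = (1 + erf ((q - v - \<rho> * t) / (s * sqrt 2))) / 2
         - exp (b * (\<rho> * t) + b\<^sup>2 * s\<^sup>2 / 2 - b * q) * ((1 + erf ((q - v - (\<rho> * t + b * s\<^sup>2)) / (s * sqrt 2))) / 2)"
proof -
  interpret prob_space M using gmsi by (simp add: gmsi_process_def)
  let ?D = "time_domain \<Delta>"
  define Z where "Z = (\<lambda>s \<omega>. \<rho> * s + X s \<omega>)"
  define B where "B = (\<lambda>s \<omega>. Z t \<omega> - Z (t - s) \<omega>)"
  define \<sigma> where "\<sigma> = sqrt (\<theta> * t)"
  have \<theta>: "0 < \<theta>" and G: "gaussian_process M ?D X" and mean: "\<And>s. s \<in> ?D \<Longrightarrow> expectation (X s) = 0"
    and Xc: "\<And>\<omega>. \<omega> \<in> space M \<Longrightarrow> continuous_on ?D (\<lambda>s. X s \<omega>)" and X0: "\<And>\<omega>. \<omega> \<in> space M \<Longrightarrow> X 0 \<omega> = 0"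
    using gmsi by (auto simp: gmsi_process_def)
  have D: "{0..t} \<subseteq> ?D"
    using t by (auto simp: time_domain_def intro: le_less_trans[of _ "ereal t"])
  have \<sigma>: "0 < \<sigma>" using \<theta> t by (simp add: \<sigma>_def)
  have s: "0 < s" using t \<tau> by (simp add: s_def)
  have W: "distributed M lborel (Z t) (normal_density (\<rho> * t) s)"
    unfolding Z_def s_def by (rule gmsi_process_endpoint[OF gmsi t \<tau>])
  have Zm: "Z r \<in> borel_measurable M" if "r \<in> {0..t}" for r
  proof -
    have "gaussian_rv M (X r)"
      by (rule gaussian_process_lin_span(1)[OF G mean lin_span_base]) (use that D in auto)
    then have [measurable]: "X r \<in> borel_measurable M" by (simp add: gaussian_rv_def)
    show ?thesis unfolding Z_def by measurable
  qed
  have [measurable]: "Z t \<in> borel_measurable M" using Zm t by auto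
  have Zc: "continuous_on {0..t} (\<lambda>s. Z s \<omega>)" if "\<omega> \<in> space M" for \<omega>
    unfolding Z_def by (intro continuous_intros continuous_on_subset[OF Xc[OF that] D])
  define N where "N = density M (\<lambda>\<omega>. normal_density 0 \<sigma> (Z t \<omega>) / normal_density (\<rho> * t) s (Z t \<omega>))"
  interpret N: prob_space N unfolding N_def by (rule prob_space_reweight(1)[OF W s \<sigma>])
  have spN: "space N = space M" and setsN: "sets N = events"
    by (simp_all add: N_def)
  have mN: "f \<in> borel_measurable N" if "f \<in> borel_measurable M" for f :: "'a \<Rightarrow> real"
    using that by (simp add: N_def)
  have Bm: "B r \<in> borel_measurable M" if "r \<in> {0..t}" for r
    unfolding B_def using that by (intro borel_measurable_diff Zm) (use t in auto)
  let ?inc = "\<lambda>n i \<omega>. B (t * real (Suc i) / real n) \<omega> - B (t * real i / real n) \<omega>"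
  have grid: "t * real k / real n \<in> {0..t}" if "k \<le> n" for k n :: nat
    using that t by (cases "n = 0") (auto simp: field_simps)
  have incm: "?inc n i \<in> borel_measurable M" if "i < n" for n i
    using that by (intro borel_measurable_diff Bm grid) auto
  have joint: "(LINT \<omega>|N. (\<Prod>i<n. iexp (u i * ?inc n i \<omega>))) = (\<Prod>i<n. exp (- ((u i)\<^sup>2 * (\<theta> * t / n)) / 2))"
    if "0 < n" for n u
    using gmsi_process_reweighted_increments[OF gmsi t W[unfolded Z_def] s N_def[unfolded \<sigma>_def Z_def] that, of u]
    unfolding B_def Z_def .
  \<comment> \<open>Setting all frequencies but one to \<open>0\<close> gives the marginals, whose
    product is the joint characteristic function.\<close>
  have single: "char (distr N borel (?inc n i)) x = exp (- (x\<^sup>2 * (\<theta> * t / n)) / 2)" if i: "i < n" for n i x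
  proof -
    let ?u = "\<lambda>j. if j = i then x else 0"
    have "char (distr N borel (?inc n i)) x = (LINT \<omega>|N. iexp (x * ?inc n i \<omega>))"
      unfolding char_def by (subst integral_distr[OF mN[OF incm[OF i]]]) auto
    also have "\<dots> = (LINT \<omega>|N. (\<Prod>j<n. iexp (?u j * ?inc n j \<omega>)))"
    proof (intro Bochner_Integration.integral_cong refl)
      fix \<omega>
      have "(\<Prod>j<n. iexp (?u j * ?inc n j \<omega>)) = (\<Prod>j<n. if j = i then iexp (x * ?inc n i \<omega>) else 1)"
        by (intro prod.cong) auto
      then show "iexp (x * ?inc n i \<omega>) = (\<Prod>j<n. iexp (?u j * ?inc n j \<omega>))" using i by simp
    qed
    also have "\<dots> = (\<Prod>j<n. exp (- ((?u j)\<^sup>2 * (\<theta> * t / n)) / 2))" using joint[of n ?u] i by simp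
    also have "(\<Prod>j<n. exp (- ((?u j)\<^sup>2 * (\<theta> * t / n)) / 2)) = (\<Prod>j<n. if j = i then exp (- (x\<^sup>2 * (\<theta> * t / n)) / 2) else 1)"
      by (intro prod.cong) auto
    also have "\<dots> = exp (- (x\<^sup>2 * (\<theta> * t / n)) / 2)" using i by simp
    finally show ?thesis .
  qed
  \<comment> \<open>All levels \<open>c \<le> q\<close> are covered, as undoing the weight needs the
    whole law of the endpoint on the crossing event.\<close>
  have refl: "{\<omega> \<in> space N. (\<exists>s\<in>{0..t}. q < B s \<omega>) \<and> B t \<omega> \<le> c} \<in> sets N"
    "N.prob {\<omega> \<in> space N. (\<exists>s\<in>{0..t}. q < B s \<omega>) \<and> B t \<omega> \<le> c} = N.prob {\<omega> \<in> space N. 2 * q - c < B t \<omega>}"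
    if c: "c \<le> q" for c
  proof -
    have R1: "continuous_on {0..t} (\<lambda>s. B s \<omega>)" if "\<omega> \<in> space N" for \<omega>
      unfolding B_def using that spN
      by (intro continuous_intros continuous_on_compose2[OF Zc]) auto
    have R2: "B 0 \<omega> = 0" for \<omega> by (simp add: B_def)
    have R3: "B r \<in> borel_measurable N" if "r \<in> {0..t}" for r by (rule mN[OF Bm[OF that]])
    have R4: "N.indep_vars (\<lambda>_. borel) (?inc n) {..<n}" if "0 < n" for n
    proof (rule N.indep_vars_from_char)
      fix u show "(LINT \<omega>|N. (\<Prod>i<n. iexp (u i * ?inc n i \<omega>))) = (\<Prod>i<n. char (distr N borel (?inc n i)) (u i))"
        unfolding joint[OF that] of_real_prod by (rule prod.cong) (simp_all only: single lessThan_iff)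
    next
      fix i assume "i \<in> {..<n}"
      then show "?inc n i \<in> borel_measurable N" by (intro mN incm) simp
    qed (use that in auto)
    have R5: "char (distr N borel (?inc n i)) (- x) = char (distr N borel (?inc n i)) x" if "i < n" for n i x
      using single[OF that] by simp
    note R = N.continuous_reflection[OF t(1) R1 R2 R3 R4 R5 q c]
    show "{\<omega> \<in> space N. (\<exists>s\<in>{0..t}. q < B s \<omega>) \<and> B t \<omega> \<le> c} \<in> sets N" by (rule R(1))
    show "N.prob {\<omega> \<in> space N. (\<exists>s\<in>{0..t}. q < B s \<omega>) \<and> B t \<omega> \<le> c} = N.prob {\<omega> \<in> space N. 2 * q - c < B t \<omega>}" by (rule R(2))
  qed
  define P where "P = (\<lambda>\<omega>. \<exists>r\<in>{0..t}. q < Z t \<omega> - Z r \<omega>)"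
  have PB: "P \<omega> \<longleftrightarrow> (\<exists>r\<in>{0..t}. q < B r \<omega>)" for \<omega>
    unfolding P_def B_def by (auto intro: bexI[of _ "t - _"])
  \<comment> \<open>Because \<open>Z\<close> starts at \<open>0\<close>, the reversed path ends in
    \<open>Z t\<close>, so reflection concerns the variable that carries the weight.\<close>
  have Bt: "B t \<omega> = Z t \<omega>" if "\<omega> \<in> space M" for \<omega> using X0[OF that] by (simp add: B_def Z_def)
  have ev: "{\<omega> \<in> space N. (\<exists>s\<in>{0..t}. q < B s \<omega>) \<and> B t \<omega> \<le> c} = {\<omega> \<in> space M. P \<omega> \<and> Z t \<omega> \<le> c}"
    "{\<omega> \<in> space N. 2 * q - c < B t \<omega>} = {\<omega> \<in> space M. 2 * q - c < Z t \<omega>}" for c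
    using Bt by (auto simp: spN PB)
  have cross: "prob {\<omega> \<in> space M. P \<omega> \<and> Z t \<omega> \<le> q - v}
     = exp (b * (\<rho> * t) + b\<^sup>2 * s\<^sup>2 / 2 - b * q) * ((1 + erf ((q - v - (\<rho> * t + b * s\<^sup>2)) / (s * sqrt 2))) / 2)"
  proof -
    have "\<sigma>\<^sup>2 = \<theta> * t" using \<theta> t by (simp add: \<sigma>_def)
    then show ?thesis
      using crossing_prob_reweight[OF W s \<sigma> N_def, of "q - v" P q] refl v
      unfolding ev b_def setsN by auto
  qed
  have end_le: "prob {\<omega> \<in> space M. Z t \<omega> \<le> q - v} = (1 + erf ((q - v - \<rho> * t) / (s * sqrt 2))) / 2"
  proof -
    have "emeasure M (Z t -` {..q - v} \<inter> space M) = (\<integral>\<^sup>+x. ennreal (normal_density (\<rho> * t) s x) * indicator {..q - v} x \<partial>lborel)"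
      by (rule distributed_emeasure[OF W]) auto
    also have "\<dots> = (\<integral>\<^sup>+x. ennreal (indicator {..q - v} x * normal_density (\<rho> * t) s x) \<partial>lborel)"
      by (intro nn_integral_cong) (auto simp: indicator_def)
    also have "\<dots> = ennreal ((1 + erf ((q - v - \<rho> * t) / (s * sqrt 2))) / 2)"
      by (rule nn_integral_normal_density_atMost[OF s])
    finally have "ennreal (prob {\<omega> \<in> space M. Z t \<omega> \<le> q - v}) = ennreal ((1 + erf ((q - v - \<rho> * t) / (s * sqrt 2))) / 2)"
      by (simp add: emeasure_eq_measure vimage_def Int_def conj_commute)
    then show ?thesis using erf_normal_nonneg[OF s] by (subst (asm) ennreal_inj) auto
  qed
  have "{\<omega> \<in> space M. Q t \<omega> \<le> q} = {\<omega> \<in> space M. Z t \<omega> \<le> q - v} - {\<omega> \<in> space M. P \<omega> \<and> Z t \<omega> \<le> q - v}"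
  proof -
    have "Q t \<omega> \<le> q \<longleftrightarrow> Z t \<omega> \<le> q - v \<and> \<not> P \<omega>" if w: "\<omega> \<in> space M" for \<omega>
    proof -
      have "Q t \<omega> \<le> q \<longleftrightarrow> v + Z t \<omega> \<le> q \<and> (\<forall>s\<in>{0..t}. Z t \<omega> - Z s \<omega> \<le> q)"
        using queue_le_iff[OF Q[OF w] Zc[OF w, unfolded Z_def] t, of q] unfolding Z_def .
      moreover have "\<not> P \<omega> \<longleftrightarrow> (\<forall>s\<in>{0..t}. Z t \<omega> - Z s \<omega> \<le> q)"
        unfolding P_def by (meson not_le)
      ultimately show ?thesis by auto
    qed
    then show ?thesis by blast
  qed
  also have "prob \<dots> = prob {\<omega> \<in> space M. Z t \<omega> \<le> q - v} - prob {\<omega> \<in> space M. P \<omega> \<and> Z t \<omega> \<le> q - v}"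
    using refl(1)[of "q - v"] v unfolding ev setsN by (intro finite_measure_Diff) auto
  finally show ?thesis unfolding cross end_le .
qed

section \<open>Continuity of the closed form at \<open>\<tau> = 0\<close>\<close>

theorem corollary4:
  fixes \<theta> \<rho> v t q :: real
    and M :: "real \<Rightarrow> 'a measure"
    and \<Delta> :: "real \<Rightarrow> ereal"
    and X Q :: "real \<Rightarrow> real \<Rightarrow> 'a \<Rightarrow> real"
  assumes "0 < \<theta>" "0 \<le> v" "0 < t" "0 \<le> q"
    and "\<And>\<tau>. \<tau> \<noteq> 0 \<Longrightarrow> \<tau> * t < \<theta> \<Longrightarrow> ereal t < \<Delta> \<tau>"
    and "\<And>\<tau>. \<tau> \<noteq> 0 \<Longrightarrow> \<tau> * t < \<theta> \<Longrightarrow> gmsi_process (M \<tau>) \<theta> \<tau> (\<Delta> \<tau>) (X \<tau>)"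
    and "\<And>\<tau> \<omega>. \<tau> \<noteq> 0 \<Longrightarrow> \<tau> * t < \<theta> \<Longrightarrow> \<omega> \<in> space (M \<tau>) \<Longrightarrow>
           queue_length_path (time_domain (\<Delta> \<tau>)) v (\<lambda>s. \<rho> * s + X \<tau> s \<omega>) (\<lambda>s. Q \<tau> s \<omega>)"
  shows "((\<lambda>\<tau>. measure (M \<tau>) {\<omega> \<in> space (M \<tau>). Q \<tau> t \<omega> \<le> q}) \<longlongrightarrow>
           1 / 2 * (1 - exp (2 * \<rho> * q / \<theta>)
             - erf ((- q + \<rho> * t + v) / sqrt (2 * \<theta> * t))
             + exp (2 * \<rho> * q / \<theta>) * erf ((q + \<rho> * t + v) / sqrt (2 * \<theta> * t)))) (at 0)"
proof -
  define b where "b = 2 * q / (\<theta> * t)"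
  define s where "s = (\<lambda>\<tau>. sqrt (t * (\<theta> - \<tau> * t)))"
  \<comment> \<open>The closed form; \<open>\<tau>\<close> enters through \<open>s\<close> only,
    since \<open>b\<close> belongs to the reference variance \<open>\<theta> * t\<close>.\<close>
  define F where "F = (\<lambda>\<tau>. (1 + erf ((q - v - \<rho> * t) / (s \<tau> * sqrt 2))) / 2
         - exp (b * (\<rho> * t) + b\<^sup>2 * (s \<tau>)\<^sup>2 / 2 - b * q)
           * ((1 + erf ((q - v - (\<rho> * t + b * (s \<tau>)\<^sup>2)) / (s \<tau> * sqrt 2))) / 2))"
  have s0: "(s 0)\<^sup>2 = \<theta> * t" "s 0 * sqrt 2 = sqrt (2 * \<theta> * t)" 
    and s_pos: "0 < s 0"
    using assms(1,3) by (simp_all add: s_def mult_ac flip: real_sqrt_mult)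
  have "isCont s 0" unfolding s_def by (intro continuous_intros)
  then have "isCont F 0"
    unfolding F_def using s_pos
    by (intro continuous_intros isCont_o2[OF _ isCont_erf]) auto
  then have "(F \<longlongrightarrow> F 0) (at 0)" by (simp add: isCont_def)
  \<comment> \<open>The closed form is available for \<open>\<tau> \<noteq> 0\<close> with
    \<open>\<tau> * t < \<theta>\<close>, which covers a punctured neighbourhood of
    \<open>0\<close>; this suffices for the limit.\<close>
  moreover have "\<forall>\<^sub>F \<tau> in at 0. F \<tau> = measure (M \<tau>) {\<omega> \<in> space (M \<tau>). Q \<tau> t \<omega> \<le> q}"
  proof -
    have "((\<lambda>\<tau>. \<tau> * t) \<longlongrightarrow> 0 * t) (at 0)" by (intro tendsto_intros)
    then have "\<forall>\<^sub>F \<tau> in at 0. \<tau> * t < \<theta>" using assms(1) by (auto intro: order_tendstoD)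
    moreover have "\<forall>\<^sub>F \<tau> in at (0::real). \<tau> \<noteq> 0" by (simp add: eventually_at_filter)
    ultimately show ?thesis
    proof eventually_elim
      case (elim \<tau>)
      show ?case unfolding F_def b_def s_def
        by (rule gmsi_queue_distribution[symmetric]) (use assms elim in auto)
    qed
  qed
  moreover have "F 0 = 1 / 2 * (1 - exp (2 * \<rho> * q / \<theta>)
             - erf ((- q + \<rho> * t + v) / sqrt (2 * \<theta> * t))
             + exp (2 * \<rho> * q / \<theta>) * erf ((q + \<rho> * t + v) / sqrt (2 * \<theta> * t)))"
  proof -
    \<comment> \<open>At \<open>\<tau> = 0\<close> the true and the reference variance agree, so
      \<open>b\<^sup>2 * (\<theta> * t) / 2 = b * q\<close> and only the drift term remains in the
      exponent.\<close>
    have "b * (\<rho> * t) + b\<^sup>2 * (\<theta> * t) / 2 - b * q = 2 * \<rho> * q / \<theta>"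
      using assms(1,3) by (simp add: b_def field_simps power2_eq_square)
    moreover have "q - v - (\<rho> * t + b * (\<theta> * t)) = - (q + \<rho> * t + v)"
      using assms(1,3) by (simp add: b_def)
    moreover have "q - v - \<rho> * t = - (- q + \<rho> * t + v)" by simp
    ultimately have "F 0 = (1 + erf (- (- q + \<rho> * t + v) / sqrt (2 * \<theta> * t))) / 2
        - exp (2 * \<rho> * q / \<theta>) * ((1 + erf (- (q + \<rho> * t + v) / sqrt (2 * \<theta> * t))) / 2)"
      by (simp only: F_def s0)
    then show ?thesis
      by (simp only: minus_divide_left[symmetric] erf_minus) (simp add: algebra_simps diff_divide_distrib add_divide_distrib)
  qed
  ultimately show ?thesis using tendsto_cong by force
qed

end
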